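(* The orbitopal fixing problem for partitioning orbitopes can be solved in time $O(pq)$. That is, there is an algorithm which, given integers $p\ge q\ge 2$ and subsets $I_0,I_1\subseteq\mathcal{I}_{p,q}$ satisfying properties (P1) and (P2), runs in time $O(pq)$ and either determines that $\mathrm{Fix}_F(\mathrm{O}^{=}_{p,q})=\varnothing$, or computes the pair $(I_0^\star,I_1^\star)$ defining the cube face $\mathrm{Fix}_F(\mathrm{O}^{=}_{p,q})$, where $F$ is the face of the cube $[0,1]^{\mathcal{I}_{p,q}}$ defined by $(I_0,I_1)$.
   Context: Notation: $[n]=\{1,\dots,n\}$. Let $p\ge q\ge 2$ be integers, $q(i)=\min\{i,q\}$, $\mathcal{I}_{p,q}=\{(i,j)\in[p]\times[q] : i\ge j\}$ and $\mathrm{row}_i=\{(i,j): j\in[q(i)]\}$. Partitioning orbitope: $\mathrm{O}^{=}_{p,q}$ is the convex hull of all 0/1-matrices $x\in\{0,1\}^{[p]\times[q]}$ with exactly one 1-entry per row whose columns are in non-increasing lexicographical order, i.e. $\sum_{i=1}^p 2^{p-i}x_{ij}\ge\sum_{i=1}^p 2^{p-i}x_{i,j+1}$ for all $j\in[q-1]$. Since all such matrices have $x_{ij}=0$ for $i<j$, these components are dropped and $\mathrm{O}^{=}_{p,q}$ is regarded as a subset of $\mathbb{R}^{\mathcal{I}_{p,q}}$. Cube faces and fixing: for disjoint $I_0,I_1\subseteq\mathcal{I}_{p,q}$, the face of the cube $[0,1]^{\mathcal{I}_{p,q}}$ defined by $(I_0,I_1)$ is $\{x\in[0,1]^{\mathcal{I}_{p,q}}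 : x_{ij}=0 \text{ for } (i,j)\in I_0,\ x_{ij}=1\text{ for }(i,j)\in I_1\}$. For a polytope $P\subseteq[0,1]^{\mathcal{I}_{p,q}}$ and a face $F$ of the cube, $\mathrm{Fix}_F(P)$ is the smallest face of the cube containing all 0/1-points of $P\cap F$ (the empty face if there are none). If nonempty, it is defined by the pair $(I_0^\star,I_1^\star)$, where $I_0^\star$ (resp. $I_1^\star$) is the set of all indices $(i,j)$ with $x_{ij}=0$ (resp. $x_{ij}=1$) for all 0/1-points $x\in P\cap F$. Properties: (P1) $|I_0\cap\mathrm{row}_i|\le q(i)-1$ for all $i\in[p]$. (P2) For all $(i,j)\in I_1$, we have $(i,\ell)\in I_0$ for all $\ell\in[q(i)]\setminus\{j\}$. (Together they imply $I_0\cap I_1=\varnothing$.) *)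

theory Defs
  imports "HOL-Analysis.Analysis" "HOL-Analysis.Finite_Function_Topology"
begin

section \<open>Partitioning orbitopes\<close>

text \<open>
  Since \<open>p\<close> and \<open>q\<close> are quantified variables, a vector indexed by a finite set \<open>S\<close> of pairs is
  represented by a finitely supported function whose support is contained in \<open>S\<close>.
  Extending by zeros and dropping components that are zero are then both the identity.
\<close>

type_synonym point = "(nat \<times> nat) \<Rightarrow>\<^sub>0 real"

abbreviation entry :: "point \<Rightarrow> nat \<Rightarrow> nat \<Rightarrow> real" where
  "entry x i j \<equiv> Poly_Mapping.lookup x (i, j)"

definition row_len :: "nat \<Rightarrow> nat \<Rightarrow> nat" where
  "row_len q i = min i q"

definition indices :: "nat \<Rightarrow> nat \<Rightarrow> (nat \<times> nat) set" where
  "indices p q = {(i, j). i \<in> {1..p} \<and> j \<in> {1..q} \<and> j \<le> i}"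

definition row :: "nat \<Rightarrow> nat \<Rightarrow> (nat \<times> nat) set" where
  "row q i = {(i, j) | j. j \<in> {1..row_len q i}}"

definition lex_partition_matrices :: "nat \<Rightarrow> nat \<Rightarrow> point set" where
  "lex_partition_matrices p q =
    {x. Poly_Mapping.keys x \<subseteq> {1..p} \<times> {1..q} \<and>
        (\<forall>i\<in>{1..p}. \<forall>j\<in>{1..q}. entry x i j \<in> {0, 1}) \<and>
        (\<forall>i\<in>{1..p}. \<exists>!j. j \<in> {1..q} \<and> entry x i j = 1) \<and>
        (\<forall>j\<in>{1..q - 1}. (\<Sum>i=1..p. 2 ^ (p - i) * entry x i j)
                        \<ge> (\<Sum>i=1..p. 2 ^ (p - i) * entry x i (j + 1)))}"

definition partitioning_orbitope :: "nat \<Rightarrow> nat \<Rightarrow> point set" where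
  "partitioning_orbitope p q = convex hull (lex_partition_matrices p q)"

text \<open>The entries above the diagonal vanish, so no projection is needed in the definition above.\<close>

lemma lex_partition_matrices_triangular:
  assumes x: "x \<in> lex_partition_matrices p q"
  shows "Poly_Mapping.keys x \<subseteq> indices p q"
proof -
  note x' = x[unfolded lex_partition_matrices_def mem_Collect_eq]
  note sub = x'[THEN conjunct1]
  note bin' = x'[THEN conjunct2, THEN conjunct1]
  note ex1 = x'[THEN conjunct2, THEN conjunct2, THEN conjunct1]
  note lex = x'[THEN conjunct2, THEN conjunct2, THEN conjunct2]
  have le: "j \<le> i" if "i \<in> {1..p}" "j \<in> {1..q}" "entry x i j \<noteq> 0" for i j
    using that
  proof (induction i arbitrary: j rule: less_induct)
    case (less i)
    have bin: "entry x k l \<in> {0, 1}" if "k \<in> {1..p}" "l \<in> {1..q}" for k l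
      using bin' that by blast
    have one: "entry x i j = 1" using bin[OF less.prems(1,2)] less.prems(3) by simp
    show ?case
    proof (rule ccontr)
      assume "\<not> j \<le> i"
      then have j: "2 \<le> j" "i < j" using less.prems by auto
      define j' where "j' = j - 1"
      have j': "j' \<in> {1..q - 1}" "j = j' + 1" "j' \<in> {1..q}" using j less.prems by (auto simp: j'_def)
      have ge: "(\<Sum>k=1..p. 2 ^ (p - k) * entry x k j) \<le> (\<Sum>k=1..p. 2 ^ (p - k) * entry x k j')"
        unfolding j'(2) using lex j'(1) by (rule bspec)
      have "2 ^ (p - i) * entry x i j \<le> (\<Sum>k=1..p. 2 ^ (p - k) * entry x k j)"
      proof (rule member_le_sum)
        fix k assume "k \<in> {1..p} - {i}"
        then have "entry x k j \<in> {0, 1}" using bin less.prems(2) by simp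
        then show "0 \<le> 2 ^ (p - k) * entry x k j" by auto
      qed (use less.prems in auto)
      then have low: "2 ^ (p - i) \<le> (\<Sum>k=1..p. 2 ^ (p - k) * entry x k j')"
        using ge unfolding one by linarith
      have "\<exists>k\<in>{1..i}. entry x k j' \<noteq> 0"
      proof (rule ccontr)
        assume z: "\<not> ?thesis"
        have "(\<Sum>k=1..p. 2 ^ (p - k) * entry x k j') \<le> (\<Sum>k\<in>{i<..p}. 2 ^ (p - k))"
        proof -
          have "(\<Sum>k=1..p. 2 ^ (p - k) * entry x k j') = (\<Sum>k\<in>{i<..p}. 2 ^ (p - k) * entry x k j')"
            using z less.prems(1) by (intro sum.mono_neutral_right) auto
          also have "\<dots> \<le> (\<Sum>k\<in>{i<..p}. 2 ^ (p - k))"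
          proof (rule sum_mono)
            fix k assume "k \<in> {i<..p}"
            then have "entry x k j' \<in> {0, 1}" using bin j'(3) less.prems(1) by simp
            then show "2 ^ (p - k) * entry x k j' \<le> 2 ^ (p - k)" by auto
          qed
          finally show ?thesis .
        qed
        also have "(\<Sum>k\<in>{i<..p}. (2::real) ^ (p - k)) = (\<Sum>m<p - i. 2 ^ m)"
          using less.prems
          by (intro sum.reindex_bij_witness[of _ "\<lambda>m. p - m" "\<lambda>k. p - k"]) auto
        also have "\<dots> = 2 ^ (p - i) - 1" by (simp add: geometric_sum)
        finally show False using low by simp
      qed
      then obtain k where k: "k \<in> {1..i}" "entry x k j' \<noteq> 0" by blast
      have "k \<noteq> i"
      proof
        assume "k = i"
        then have "entry x i j' = 1" using bin[OF less.prems(1) j'(3)] k(2) by simp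
        moreover have "\<exists>!l. l \<in> {1..q} \<and> entry x i l = 1"
          using ex1 less.prems(1) by (rule bspec)
        ultimately have "j' = j" using one less.prems(2) j'(3) by (metis (no_types))
        then show False using j'(2) by simp
      qed
      then have "j' \<le> k" using less.IH[of k j'] k j'(3) less.prems(1) by simp
      then show False using k \<open>k \<noteq> i\<close> j j'(2) by auto
    qed
  qed
  show ?thesis
  proof
    fix z assume z: "z \<in> Poly_Mapping.keys x"
    obtain i j where ij: "z = (i, j)" by (cases z)
    have "i \<in> {1..p}" "j \<in> {1..q}" using subsetD[OF sub z] ij by simp_all
    moreover have "entry x i j \<noteq> 0" using z ij by (simp add: in_keys_iff)
    ultimately show "z \<in> indices p q" using le[of i j] ij unfolding indices_def by simp
  qed
qed


section \<open>Faces of the cube and fixing\<close>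

definition cube :: "nat \<Rightarrow> nat \<Rightarrow> point set" where
  "cube p q = {x. Poly_Mapping.keys x \<subseteq> indices p q \<and>
                  (\<forall>(i, j)\<in>indices p q. 0 \<le> entry x i j \<and> entry x i j \<le> 1)}"

definition cube_face :: "nat \<Rightarrow> nat \<Rightarrow> (nat \<times> nat) set \<Rightarrow> (nat \<times> nat) set \<Rightarrow> point set" where
  "cube_face p q I0 I1 = {x \<in> cube p q. (\<forall>(i, j)\<in>I0. entry x i j = 0) \<and>
                                        (\<forall>(i, j)\<in>I1. entry x i j = 1)}"

definition binary_points :: "nat \<Rightarrow> nat \<Rightarrow> point set \<Rightarrow> point set" where
  "binary_points p q X = {x \<in> X. \<forall>(i, j)\<in>indices p q. entry x i j \<in> {0, 1}}"

definition Fix :: "nat \<Rightarrow> nat \<Rightarrow> point set \<Rightarrow> point set \<Rightarrow> point set" where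
  "Fix p q F P = (LEAST G. G face_of cube p q \<and> binary_points p q (P \<inter> F) \<subseteq> G)"

definition fixed_to :: "real \<Rightarrow> nat \<Rightarrow> nat \<Rightarrow> point set \<Rightarrow> point set \<Rightarrow> (nat \<times> nat) set" where
  "fixed_to v p q F P =
    {(i, j) \<in> indices p q. \<forall>x\<in>binary_points p q (P \<inter> F). entry x i j = v}"

definition P1 :: "nat \<Rightarrow> nat \<Rightarrow> (nat \<times> nat) set \<Rightarrow> bool" where
  "P1 p q I0 \<longleftrightarrow> (\<forall>i\<in>{1..p}. card (I0 \<inter> row q i) \<le> row_len q i - 1)"

definition P2 :: "nat \<Rightarrow> (nat \<times> nat) set \<Rightarrow> (nat \<times> nat) set \<Rightarrow> bool" where
  "P2 q I0 I1 \<longleftrightarrow> (\<forall>(i, j)\<in>I1. \<forall>l\<in>{1..row_len q i} - {j}. (i, l) \<in> I0)"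


section \<open>Algorithms and running time\<close>

text \<open>
  A random access machine with registers and finitely many arrays per program (arrays and registers
  are named by literals in the program text; array cells are addressed indirectly, through the
  content of a register). Programs are structured, and their only arithmetic is addition and
  truncated subtraction. Every elementary instruction and every evaluation of a test takes one unit
  of time. To keep unit cost realistic, the machine has a bounded word: an instruction can only be
  executed if the number it produces is at most \<open>W\<close>, and otherwise the execution is stuck, i.e.
  has no result.
\<close>

datatype test =
    Less nat nat
  | Equal nat nat

datatype com =
    Skip
  | Const nat nat
  | Add nat nat nat
  | Sub nat nat nat
  | Load nat nat nat
  | Store nat nat nat
  | Seq com com
  | Cond test com com
  | While test com

type_synonym registers = "nat \<Rightarrow> nat"
type_synonym arrays = "nat \<Rightarrow> nat \<Rightarrow> nat"
type_synonym state = "registers \<times> arrays"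

fun holds :: "test \<Rightarrow> registers \<Rightarrow> bool" where
  "holds (Less x y) r \<longleftrightarrow> r x < r y"
| "holds (Equal x y) r \<longleftrightarrow> r x = r y"

text \<open>
  \<open>exec W c s t s'\<close>: with word bound \<open>W\<close>, program \<open>c\<close> started in state \<open>s\<close> halts after exactly \<open>t\<close>
  steps in state \<open>s'\<close>.
\<close>

inductive exec :: "nat \<Rightarrow> com \<Rightarrow> state \<Rightarrow> nat \<Rightarrow> state \<Rightarrow> bool" for W where
  Skip: "exec W Skip s 1 s"
| Const: "n \<le> W \<Longrightarrow> exec W (Const x n) (r, m) 1 (r(x := n), m)"
| Add: "r y + r z \<le> W \<Longrightarrow> exec W (Add x y z) (r, m) 1 (r(x := r y + r z), m)"
| Sub: "r y - r z \<le> W \<Longrightarrow> exec W (Sub x y z) (r, m) 1 (r(x := r y - r z), m)"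
| Load: "m a (r y) \<le> W \<Longrightarrow> exec W (Load x a y) (r, m) 1 (r(x := m a (r y)), m)"
| Store: "r y \<le> W \<Longrightarrow> exec W (Store a x y) (r, m) 1 (r, m(a := (m a)(r x := r y)))"
| Seq: "exec W c1 s t1 s' \<Longrightarrow> exec W c2 s' t2 s'' \<Longrightarrow> exec W (Seq c1 c2) s (t1 + t2) s''"
| Cond_true: "holds b (fst s) \<Longrightarrow> exec W c1 s t s' \<Longrightarrow> exec W (Cond b c1 c2) s (1 + t) s'"
| Cond_false: "\<not> holds b (fst s) \<Longrightarrow> exec W c2 s t s' \<Longrightarrow> exec W (Cond b c1 c2) s (1 + t) s'"
| While_false: "\<not> holds b (fst s) \<Longrightarrow> exec W (While b c) s 1 s"
| While_true: "holds b (fst s) \<Longrightarrow> exec W c s t1 s' \<Longrightarrow> exec W (While b c) s' t2 s'' \<Longrightarrow>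
    exec W (While b c) s (1 + t1 + t2) s''"

inductive_cases exec_SkipE: "exec W Skip s t s'"
inductive_cases exec_ConstE: "exec W (Const x n) s t s'"
inductive_cases exec_AddE: "exec W (Add x y z) s t s'"
inductive_cases exec_SubE: "exec W (Sub x y z) s t s'"
inductive_cases exec_LoadE: "exec W (Load x a y) s t s'"
inductive_cases exec_StoreE: "exec W (Store a x y) s t s'"
inductive_cases exec_SeqE: "exec W (Seq c1 c2) s t s'"
inductive_cases exec_CondE: "exec W (Cond b c1 c2) s t s'"
inductive_cases exec_WhileE: "exec W (While b c) s t s'"

lemma exec_deterministic:
  "exec W c s t s' \<Longrightarrow> exec W c s u s'' \<Longrightarrow> u = t \<and> s'' = s'"
proof (induction arbitrary: u s'' rule: exec.induct)
  case (Seq c1 s t1 s' c2 t2 s2)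
  from Seq.prems obtain v w r where "exec W c1 s v r" "exec W c2 r w s''" "u = v + w"
    by (rule exec_SeqE)
  then show ?case using Seq.IH(1)[of v r] Seq.IH(2)[of w s''] by simp
next
  case (Cond_true b s c1 t s' c2)
  from Cond_true.prems show ?case
    by (rule exec_CondE) (simp_all add: Cond_true.hyps(1) Cond_true.IH)
next
  case (Cond_false b s c2 t s' c1)
  from Cond_false.prems show ?case
    by (rule exec_CondE) (simp_all add: Cond_false.hyps(1) Cond_false.IH)
next
  case (While_false b s c)
  from While_false.prems show ?case
    by (rule exec_WhileE) (simp_all add: While_false.hyps)
next
  case (While_true b s c t1 s' t2 s2)
  from While_true.prems show ?case
  proof (rule exec_WhileE)
    fix v r w assume "u = Suc (v + w)" "exec W c s v r" "exec W (While b c) r w s''"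
    then show ?thesis using While_true.IH(1)[of v r] While_true.IH(2)[of w s''] by simp
  qed (simp_all add: While_true.hyps(1))
qed (erule exec_SkipE exec_ConstE exec_AddE exec_SubE exec_LoadE exec_StoreE, simp)+

text \<open>
  Subsets of the index set are stored as row-major characteristic 0/1-vectors: address \<open>k < p * q\<close>
  belongs to the \<open>k\<close>-th position (from 0) of the \<open>p \<times> q\<close> matrix, whose indices start at 1.
\<close>

definition position :: "nat \<Rightarrow> nat \<Rightarrow> nat \<times> nat" where
  "position q k = (k div q + 1, k mod q + 1)"

definition stores_set :: "nat \<Rightarrow> nat \<Rightarrow> (nat \<Rightarrow> nat) \<Rightarrow> (nat \<times> nat) set \<Rightarrow> bool" where
  "stores_set p q a J \<longleftrightarrow> (\<forall>k<p * q. a k = of_bool (position q k \<in> J))"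

text \<open>
  Input: \<open>p\<close> and \<open>q\<close> in registers 0 and 1, the two sets in arrays 0 and 1, everything else 0.
\<close>

definition input_state :: "nat \<Rightarrow> nat \<Rightarrow> (nat \<times> nat) set \<Rightarrow> (nat \<times> nat) set \<Rightarrow> state" where
  "input_state p q I0 I1 =
    ((\<lambda>_. 0)(0 := p, 1 := q),
     (\<lambda>_ _. 0)(0 := (\<lambda>k. of_bool (k < p * q \<and> position q k \<in> I0)),
               1 := (\<lambda>k. of_bool (k < p * q \<and> position q k \<in> I1))))"

text \<open>
  Output: register 0 is 0 if \<open>Fix\<close> is empty; otherwise it is 1, and arrays 2 and 3 hold the pair
  of index sets defining \<open>Fix\<close>.
\<close>

definition correct_output ::
  "nat \<Rightarrow> nat \<Rightarrow> (nat \<times> nat) set \<Rightarrow> (nat \<times> nat) set \<Rightarrow> state \<Rightarrow> bool" where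
  "correct_output p q I0 I1 s \<longleftrightarrow>
    (let F = cube_face p q I0 I1;
         P = partitioning_orbitope p q;
         I0' = fixed_to 0 p q F P;
         I1' = fixed_to 1 p q F P
     in if Fix p q F P = {} then fst s 0 = 0
        else fst s 0 = 1 \<and> Fix p q F P = cube_face p q I0' I1' \<and>
             stores_set p q (snd s 2) I0' \<and> stores_set p q (snd s 3) I1')"

end

theory Submission
  imports Defs
begin

text \<open>
  A 0/1-point of the orbitope is a sequence of columns \<open>c\<close>, one per row, in which a new column may
  only be opened after all smaller ones. By (P1) and (P2) the face \<open>F\<close> merely restricts every \<open>c i\<close>
  to a nonempty set of available columns. Whether such a sequence can be completed depends only on
  the number of columns opened so far, and a larger number is never worse. So one backward pass
  computing the least number that can be completed and one forward pass computing the largest number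
  that can be reached decide for every cell whether some 0/1-point of the face uses it.
\<close>

section \<open>Faces of the cube\<close>

text \<open>Two obstacles separate the statement from sequences. \<open>Fix\<close> is a
  \<open>LEAST\<close> over faces, so a least face has to be exhibited: averaging the 0/1-points in
  question gives a point that is 0 or 1 exactly at the fixed coordinates, and every face containing
  it contains the whole cube face given by these coordinates. The lexicographic order compares whole
  columns, but since every row has a single 1, two columns never share a row and only their first
  1-entries decide. A larger height is never worse because later rows see it only as an upper bound
  on the next column and through a maximum. A cell of row \<open>i\<close> is therefore tested
  against one prefix, the highest: column \<open>high i\<close> lifts the height by one, any smaller
  column leaves it at \<open>high i\<close>, which then has to reach \<open>low (Suc i)\<close>.
  This costs constant time per cell, and the backward pass scans each row at most once, for its
  smallest available column.\<close>

lemma lookup_scaleR [simp]: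
  "Poly_Mapping.lookup (c *\<^sub>R x) k = c *\<^sub>R Poly_Mapping.lookup x k"
proof -
  have "finite {k. c *\<^sub>R Poly_Mapping.lookup x k \<noteq> 0}"
    by (rule finite_subset[OF _ finite_keys[of x]]) (auto simp: in_keys_iff)
  then show ?thesis
    by (simp add: scaleR_poly_mapping_def)
qed

lemma finite_indices: "finite (indices p q)"
  by (rule finite_subset[of _ "{1..p} \<times> {1..q}"]) (auto simp: indices_def)

text \<open>The functional \<open>f\<close> is affine and on 0/1-vectors equals the Hamming distance
  to \<open>x\<close>. If \<open>x\<close> were not in \<open>V\<close>, it would be positive on
  \<open>V\<close>, hence on the hull, yet it vanishes at \<open>x\<close>.\<close>

lemma binary_point_of_convex_hull:
  fixes x :: "'a \<Rightarrow>\<^sub>0 real"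
  assumes fin: "finite S" and keys: "\<And>y. y \<in> V \<Longrightarrow> Poly_Mapping.keys y \<subseteq> S"
    and bin: "\<And>y k. y \<in> V \<Longrightarrow> k \<in> S \<Longrightarrow> Poly_Mapping.lookup y k \<in> {0, 1}"
    and x: "x \<in> convex hull V" and xbin: "\<And>k. k \<in> S \<Longrightarrow> Poly_Mapping.lookup x k \<in> {0, 1}"
  shows "x \<in> V"
proof (rule ccontr)
  assume "x \<notin> V"
  define f :: "('a \<Rightarrow>\<^sub>0 real) \<Rightarrow> real" where "f y = (\<Sum>k\<in>S. if Poly_Mapping.lookup x k = 1
      then 1 - Poly_Mapping.lookup y k else Poly_Mapping.lookup y k)" for y
  define H :: "('a \<Rightarrow>\<^sub>0 real) set" where "H = {y. Poly_Mapping.keys y \<subseteq> S}"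
  define K where "K = {y. 0 < f y}"
  have "convex H"
    by (rule convexI) (auto simp: H_def in_keys_iff lookup_add subset_iff, metis add_0 mult_zero_right)
  then have xH: "x \<in> H" using x keys hull_minimal[of V H convex] unfolding H_def by blast
  have aff: "f (u *\<^sub>R a + v *\<^sub>R b) = u * f a + v * f b" if "u + v = 1" for u v a b
  proof -
    have v: "v = 1 - u" using that by simp
    show ?thesis unfolding f_def sum_distrib_left sum.distrib[symmetric] v
      by (rule sum.cong[OF refl], simp only: lookup_add lookup_scaleR real_scaleR_def)
        (simp add: algebra_simps)
  qed
  have "convex K"
  proof (rule convexI)
    fix a b and u v :: real
    assume "a \<in> K" "b \<in> K" and uv: "0 \<le> u" "0 \<le> v" "u + v = 1"
    then have "0 < f a" "0 < f b" by (auto simp: K_def)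
    then have "0 < u * f a + v * f b"
      using uv by (metis add_0 add_nonneg_pos add_pos_nonneg less_eq_real_def mult_pos_pos mult_zero_left zero_neq_one mult_nonneg_nonneg)
    then show "u *\<^sub>R a + v *\<^sub>R b \<in> K" using aff[OF uv(3)] by (simp add: K_def)
  qed
  have "V \<subseteq> K"
  proof
    fix y assume y: "y \<in> V"
    have "\<exists>k. Poly_Mapping.lookup y k \<noteq> Poly_Mapping.lookup x k"
      using \<open>x \<notin> V\<close> y poly_mapping_eqI by metis
    then obtain k where k: "Poly_Mapping.lookup y k \<noteq> Poly_Mapping.lookup x k" by blast
    then have "k \<in> S" using keys[OF y] xH unfolding H_def mem_Collect_eq by (metis in_keys_iff subset_iff)
    have "0 < f y" unfolding f_def
    proof (rule sum_pos2[OF fin \<open>k \<in> S\<close>])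
      show "0 < (if Poly_Mapping.lookup x k = 1 then 1 - Poly_Mapping.lookup y k else Poly_Mapping.lookup y k)"
        using bin[OF y \<open>k \<in> S\<close>] xbin[OF \<open>k \<in> S\<close>] k by auto
    qed (use bin[OF y] in fastforce)
    then show "y \<in> K" by (simp add: K_def)
  qed
  then have "x \<in> K" using x hull_minimal[of V K convex] \<open>convex K\<close> by blast
  moreover have "f x = 0" unfolding f_def by (rule sum.neutral) (use xbin in auto)
  ultimately show False by (simp add: K_def)
qed

lemma lex_partition_matrices_binary:
  assumes "x \<in> lex_partition_matrices p q" "k \<in> indices p q"
  shows "Poly_Mapping.lookup x k \<in> {0, 1}"
  using assms unfolding lex_partition_matrices_def indices_def by (cases k) auto

text \<open>This removes the convex hull: what remains is the set of generating matrices with the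
  prescribed entries.\<close>

lemma binary_points_orbitope:
  "binary_points p q (partitioning_orbitope p q \<inter> cube_face p q I0 I1) =
    {x \<in> lex_partition_matrices p q. (\<forall>(i, j)\<in>I0. entry x i j = 0) \<and> (\<forall>(i, j)\<in>I1. entry x i j = 1)}"
  (is "?L = ?R")
proof
  show "?L \<subseteq> ?R"
  proof
    fix x assume x: "x \<in> ?L"
    have "x \<in> lex_partition_matrices p q"
    proof (rule binary_point_of_convex_hull[OF finite_indices[of p q]])
      show "x \<in> convex hull (lex_partition_matrices p q)"
        using x unfolding binary_points_def partitioning_orbitope_def by blast
      show "\<And>k. k \<in> indices p q \<Longrightarrow> Poly_Mapping.lookup x k \<in> {0, 1}"
        using x unfolding binary_points_def by fastforce
    qed (use lex_partition_matrices_triangular lex_partition_matrices_binary in blast)+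
    then show "x \<in> ?R" using x unfolding binary_points_def cube_face_def by blast
  qed
  show "?R \<subseteq> ?L"
  proof
    fix x assume x: "x \<in> ?R"
    then have xl: "x \<in> lex_partition_matrices p q" by blast
    then have "x \<in> partitioning_orbitope p q"
      unfolding partitioning_orbitope_def by (rule hull_inc)
    moreover have "x \<in> cube p q"
      using lex_partition_matrices_triangular[OF xl] lex_partition_matrices_binary[OF xl]
      unfolding cube_def by fastforce
    ultimately show "x \<in> ?L" using x lex_partition_matrices_binary[OF xl]
      unfolding cube_face_def binary_points_def by fastforce
  qed
qed

section \<open>The least cube face containing a set of 0/1-points\<close>

lemma convex_cube: "convex (cube p q)"
proof (rule convexI)
  fix x y and u v :: real
  assume xy: "x \<in> cube p q" "y \<in> cube p q" and uv: "0 \<le> u" "0 \<le> v" "u + v = 1"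
  have "Poly_Mapping.keys (u *\<^sub>R x + v *\<^sub>R y) \<subseteq> indices p q"
    using xy by (auto simp: cube_def in_keys_iff lookup_add subset_iff, metis add_0 mult_zero_right)
  moreover have "0 \<le> u * entry x i j + v * entry y i j \<and> u * entry x i j + v * entry y i j \<le> 1"
    if "(i, j) \<in> indices p q" for i j
  proof -
    have "0 \<le> entry x i j" "entry x i j \<le> 1" "0 \<le> entry y i j" "entry y i j \<le> 1"
      using xy that unfolding cube_def by auto
    then show ?thesis using uv convex_bound_le[of "entry x i j" 1 "entry y i j" u v] by simp
  qed
  ultimately show "u *\<^sub>R x + v *\<^sub>R y \<in> cube p q"
    by (auto simp: cube_def lookup_add)
qed

text \<open>0 and 1 are the extreme points of the unit interval, so a coordinate at such a value
  cannot vary along a segment inside the cube.\<close>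

lemma open_segment_coordinate:
  fixes a b x :: "'a \<Rightarrow>\<^sub>0 real"
  assumes "x \<in> open_segment a b"
    and "0 \<le> Poly_Mapping.lookup a k" "Poly_Mapping.lookup a k \<le> 1"
    and "0 \<le> Poly_Mapping.lookup b k" "Poly_Mapping.lookup b k \<le> 1"
    and "Poly_Mapping.lookup x k = v" "v \<in> {0, 1}"
  shows "Poly_Mapping.lookup a k = v \<and> Poly_Mapping.lookup b k = v"
proof -
  obtain u where u: "0 < u" "u < 1" "x = (1 - u) *\<^sub>R a + u *\<^sub>R b"
    using assms(1) by (auto simp: in_segment)
  define s where "s = Poly_Mapping.lookup a k"
  define t where "t = Poly_Mapping.lookup b k"
  have eq: "(1 - u) * s + u * t = v"
    using assms(6) u(3) by (simp add: lookup_add s_def t_def)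
  have st: "0 \<le> s" "s \<le> 1" "0 \<le> t" "t \<le> 1" using assms by (auto simp: s_def t_def)
  consider "v = 0" | "v = 1" using assms(7) by blast
  then have "s = v \<and> t = v"
  proof cases
    case 1
    have "0 \<le> (1 - u) * s" "0 \<le> u * t" using st u by simp_all
    then have "(1 - u) * s = 0" "u * t = 0" using eq 1 by linarith+
    then show ?thesis using u 1 by simp
  next
    case 2
    have "0 \<le> (1 - u) * (1 - s)" "0 \<le> u * (1 - t)" using st u by simp_all
    moreover have "(1 - u) * (1 - s) + u * (1 - t) = 0" using eq 2 by (simp add: algebra_simps)
    ultimately have "(1 - u) * (1 - s) = 0" "u * (1 - t) = 0" by linarith+
    then show ?thesis using u 2 by simp
  qed
  then show ?thesis by (simp add: s_def t_def)
qed

lemma cube_face_face_of: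
  assumes "J0 \<subseteq> indices p q" "J1 \<subseteq> indices p q"
  shows "cube_face p q J0 J1 face_of cube p q"
  unfolding face_of_def
proof (intro conjI ballI impI)
  show "cube_face p q J0 J1 \<subseteq> cube p q" by (auto simp: cube_face_def)
  show "convex (cube_face p q J0 J1)"
  proof (rule convexI)
    fix x y and u v :: real
    assume xy: "x \<in> cube_face p q J0 J1" "y \<in> cube_face p q J0 J1"
      and uv: "0 \<le> u" "0 \<le> v" "u + v = 1"
    have "u *\<^sub>R x + v *\<^sub>R y \<in> cube p q"
      using convexD[OF convex_cube _ _ uv] xy by (auto simp: cube_face_def)
    then show "u *\<^sub>R x + v *\<^sub>R y \<in> cube_face p q J0 J1"
      using xy uv by (fastforce simp: cube_face_def lookup_add)
  qed
next
  fix a b x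
  assume a: "a \<in> cube p q" and b: "b \<in> cube p q" and x: "x \<in> cube_face p q J0 J1"
    and seg: "x \<in> open_segment a b"
  have coord: "entry a i j = v \<and> entry b i j = v"
    if "(i, j) \<in> indices p q" "entry x i j = v" "v \<in> {0, 1}" for i j v
    using a b that by (intro open_segment_coordinate[OF seg]) (auto simp: cube_def)
  show "a \<in> cube_face p q J0 J1" "b \<in> cube_face p q J0 J1"
    using a b x coord assms unfolding cube_face_def by fastforce+
qed

text \<open>The average of the points of \<open>S\<close> lies in the relative interior of the cube face.\<close>

lemma cube_face_subset_face:
  assumes S: "finite S" "S \<noteq> {}" "S \<subseteq> cube p q" and G: "G face_of cube p q" "S \<subseteq> G"
  shows "cube_face p q {(i, j) \<in> indices p q. \<forall>x\<in>S. entry x i j = 0}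
                       {(i, j) \<in> indices p q. \<forall>x\<in>S. entry x i j = 1} \<subseteq> G"
    (is "cube_face p q ?J0 ?J1 \<subseteq> G")
proof
  fix y assume y: "y \<in> cube_face p q ?J0 ?J1"
  define z where "z = (\<Sum>x\<in>S. (1 / real (card S)) *\<^sub>R x)"
  have card: "card S > 0" using S by (simp add: card_gt_0_iff)
  have "z \<in> G" unfolding z_def
    by (rule convex_sum[OF S(1) face_of_imp_convex[OF G(1)]]) (use card G in auto)
  then have zc: "z \<in> cube p q" using G(1) face_of_imp_subset by blast
  have yc: "y \<in> cube p q" using y by (simp add: cube_face_def)
  have ent: "entry z i j = (\<Sum>x\<in>S. entry x i j) / real (card S)" for i j
    by (simp add: z_def lookup_sum sum_divide_distrib)
  have bnd: "0 \<le> entry x i j" "entry x i j \<le> 1" if "x \<in> S" "(i, j) \<in> indices p q" for x i j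
    using that S(3) by (auto simp: cube_def)
  have pos: "0 < entry z i j" if "(i, j) \<in> indices p q" and x: "x \<in> S" "entry x i j \<noteq> 0" for i j x
  proof -
    have "0 < (\<Sum>x\<in>S. entry x i j)"
      by (rule sum_pos2[OF S(1) x(1)]) (use x bnd that in \<open>auto simp: less_le\<close>)
    then show ?thesis using card ent by simp
  qed
  have lt: "entry z i j < 1" if "(i, j) \<in> indices p q" and x: "x \<in> S" "entry x i j \<noteq> 1" for i j x
  proof -
    have "(\<Sum>x\<in>S. entry x i j) < (\<Sum>x\<in>S. 1)"
      by (rule sum_strict_mono_ex1[OF S(1)]) (use x bnd that in \<open>auto simp: less_le intro!: bexI[of _ x]\<close>)
    then show ?thesis using card ent by simp
  qed
  have z0: "entry z i j = 0" if "(i, j) \<in> ?J0" for i j using that ent by simp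
  have z1: "entry z i j = 1" if "(i, j) \<in> ?J1" for i j using that ent card by simp
  \<comment> \<open>The segment from \<open>y\<close> to \<open>z\<close> can be prolonged beyond
    \<open>z\<close> without leaving the cube. At fixed coordinates \<open>y\<close> and
    \<open>z\<close> agree, so these contribute only the neutral value 1 to the minimum; at free
    ones \<open>z\<close> is strictly between 0 and 1 and differs from \<open>y\<close> by at most
    1.\<close>
  have "\<exists>e>0. \<forall>(i, j)\<in>indices p q. 0 \<le> entry z i j + e * (entry z i j - entry y i j) \<and>
      entry z i j + e * (entry z i j - entry y i j) \<le> 1"
  proof -
    let ?M = "insert 1 ((\<lambda>(i, j). if (i, j) \<in> ?J0 then 1 else entry z i j) ` indices p q \<union>
        (\<lambda>(i, j). if (i, j) \<in> ?J1 then 1 else 1 - entry z i j) ` indices p q)"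
    define e where "e = Min ?M"
    have fin: "finite ?M" using finite_indices by simp
    have "0 < e" unfolding e_def using fin pos lt by (subst Min_gr_iff) auto
    moreover have "0 \<le> entry z i j + e * (entry z i j - entry y i j) \<and>
        entry z i j + e * (entry z i j - entry y i j) \<le> 1" if ij: "(i, j) \<in> indices p q" for i j
    proof (cases "(i, j) \<in> ?J0 \<union> ?J1")
      case True
      then have "entry z i j = entry y i j" using y z0 z1 unfolding cube_face_def by auto
      then show ?thesis using zc ij unfolding cube_def by auto
    next
      case False
      have "e \<le> entry z i j" "e \<le> 1 - entry z i j"
        unfolding e_def by (rule Min_le[OF fin], use ij False in force)+
      moreover have "0 \<le> entry y i j" "entry y i j \<le> 1" "0 \<le> entry z i j" "entry z i j \<le> 1"
        using yc zc ij by (auto simp: cube_def)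
      moreover have "\<bar>e * (entry z i j - entry y i j)\<bar> \<le> e * 1"
        unfolding abs_mult using calculation \<open>0 < e\<close> by (intro mult_mono) auto
      ultimately show ?thesis by linarith
    qed
    ultimately show ?thesis by blast
  qed
  then obtain e where e: "e > 0" and eb: "\<And>i j. (i, j) \<in> indices p q \<Longrightarrow>
      0 \<le> entry z i j + e * (entry z i j - entry y i j) \<and>
      entry z i j + e * (entry z i j - entry y i j) \<le> 1" by blast
  define w where "w = z + e *\<^sub>R (z - y)"
  have "Poly_Mapping.keys w \<subseteq> indices p q"
    using yc zc by (auto simp: cube_def w_def in_keys_iff lookup_add lookup_minus subset_iff)
      (metis diff_0_right mult_zero_right add_0)
  then have wc: "w \<in> cube p q"
    using eb by (auto simp: cube_def w_def lookup_add lookup_minus)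
  show "y \<in> G"
  proof (cases "y = z")
    case False
    have "z = (1 - 1 / (1 + e)) *\<^sub>R y + (1 / (1 + e)) *\<^sub>R w"
    proof -
      have "(1 + e) *\<^sub>R z = e *\<^sub>R y + w" by (simp add: w_def algebra_simps)
      then have "(1 / (1 + e)) *\<^sub>R ((1 + e) *\<^sub>R z) = (1 / (1 + e)) *\<^sub>R (e *\<^sub>R y + w)" by simp
      moreover have "1 - 1 / (1 + e) = e / (1 + e)" using e by (simp add: field_simps)
      ultimately show ?thesis using e by (simp add: scaleR_add_right)
    qed
    moreover have "y \<noteq> w"
    proof
      assume "y = w"
      then have "(1 + e) *\<^sub>R (z - y) = 0" by (simp add: w_def algebra_simps)
      then show False using False e by simp
    qed
    ultimately have "z \<in> open_segment y w"
      unfolding in_segment using e by (intro conjI exI[of _ "1 / (1 + e)"]) auto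
    then show ?thesis using face_ofD[OF G(1) _ yc wc \<open>z \<in> G\<close>] by blast
  qed (use \<open>z \<in> G\<close> in simp)
qed

text \<open>Inside the cube a 0/1-point is determined by its support, a subset of the finite index
  set. Finiteness is what makes the average available.\<close>

lemma finite_binary_points:
  assumes "X \<subseteq> cube p q"
  shows "finite (binary_points p q X)"
proof (rule finite_imageD)
  show "finite (Poly_Mapping.keys ` binary_points p q X)"
    by (rule finite_subset[of _ "Pow (indices p q)"])
      (use assms in \<open>auto simp: binary_points_def cube_def finite_indices\<close>)
  show "inj_on Poly_Mapping.keys (binary_points p q X)"
  proof (rule inj_onI, rule poly_mapping_eqI)
    fix x y k
    assume x: "x \<in> binary_points p q X" and y: "y \<in> binary_points p q X"
      and eq: "Poly_Mapping.keys x = Poly_Mapping.keys y"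
    show "Poly_Mapping.lookup x k = Poly_Mapping.lookup y k"
    proof (cases "k \<in> Poly_Mapping.keys x")
      case True
      then have "k \<in> indices p q" using x assms by (auto simp: binary_points_def cube_def)
      then have "Poly_Mapping.lookup x k \<in> {0, 1}" "Poly_Mapping.lookup y k \<in> {0, 1}"
        using x y by (auto simp: binary_points_def)
      then show ?thesis using True eq by (auto simp: in_keys_iff)
    qed (metis eq in_keys_iff)
  qed
qed

text \<open>The case \<open>S = {}\<close> is separate because there is nothing to average; both
  fixed sets are then all of \<open>indices p q\<close>, and the face they define is empty only if
  there is an index.\<close>

lemma Fix_eq:
  fixes P F p q
  defines "S \<equiv> binary_points p q (P \<inter> F)"
  assumes "P \<inter> F \<subseteq> cube p q"
  shows "Fix p q F P = (if S = {} then {} else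
           cube_face p q (fixed_to 0 p q F P) (fixed_to 1 p q F P))"
proof -
  let ?J = "\<lambda>v::real. {(i, j) \<in> indices p q. \<forall>x\<in>S. entry x i j = v}"
  have fx: "fixed_to v p q F P = ?J v" for v by (simp add: fixed_to_def S_def)
  have "Fix p q F P = (if S = {} then {} else cube_face p q (?J 0) (?J 1))"
    unfolding Fix_def S_def[symmetric]
  proof (rule Least_equality)
    have Sc: "S \<subseteq> cube p q" using assms by (auto simp: binary_points_def)
    show "(if S = {} then {} else cube_face p q (?J 0) (?J 1)) face_of cube p q \<and>
        S \<subseteq> (if S = {} then {} else cube_face p q (?J 0) (?J 1))"
    proof -
      have "cube_face p q (?J 0) (?J 1) face_of cube p q" by (rule cube_face_face_of) auto
      moreover have "S \<subseteq> cube_face p q (?J 0) (?J 1)" using Sc by (auto simp: cube_face_def)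
      ultimately show ?thesis by auto
    qed
    fix G assume "G face_of cube p q \<and> S \<subseteq> G"
    then show "(if S = {} then {} else cube_face p q (?J 0) (?J 1)) \<subseteq> G"
      using cube_face_subset_face[of S p q G] finite_binary_points[OF assms(2)] Sc
      by (auto simp: S_def)
  qed
  then show ?thesis by (simp only: fx)
qed


section \<open>Restricted growth sequences\<close>

text \<open>Rows and columns are counted from 0 from here on, and \<open>c i\<close> is the column of the 1-entry in
  row \<open>i\<close>.\<close>

primrec height :: "(nat \<Rightarrow> nat) \<Rightarrow> nat \<Rightarrow> nat" where
  "height c 0 = 0"
| "height c (Suc i) = max (height c i) (Suc (c i))"

lemma height_gt: "k < i \<Longrightarrow> c k < height c i"
  by (induction i) (auto simp: less_Suc_eq)

text \<open>Each row opens at most one column. Together with \<open>c i \<le> height c i\<close>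
  this keeps the 1-entry of row \<open>i\<close> on or below the diagonal.\<close>

lemma height_le: "(\<And>k. k < i \<Longrightarrow> c k \<le> height c k) \<Longrightarrow> height c i \<le> i"
proof (induction i)
  case (Suc i)
  then have "height c i \<le> i" "c i \<le> height c i" by auto
  then show ?case by simp
qed simp

text \<open>No column is skipped, so the columns used before row \<open>i\<close> form an initial
  segment and \<open>height c i\<close> is their number.\<close>

lemma height_attained:
  assumes "\<And>k. k < i \<Longrightarrow> c k \<le> height c k" "v < height c i"
  shows "\<exists>k<i. c k = v"
  using assms
proof (induction i)
  case (Suc i)
  show ?case
  proof (cases "v < height c i")
    case True
    then show ?thesis using Suc by (metis less_SucI)
  next
    case False
    then show ?thesis using Suc.prems(1)[of i] Suc.prems(2) by (intro exI[of _ i]) auto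
  qed
qed simp

text \<open>The binary number spelled by column \<open>v\<close>, top row as leading digit. The
  exponent \<open>p - Suc i\<close> is the \<open>p - i\<close> of the orbitope with rows shifted to
  start at 0.\<close>

definition col_weight :: "nat \<Rightarrow> (nat \<Rightarrow> nat) \<Rightarrow> nat \<Rightarrow> real" where
  "col_weight p c v = (\<Sum>i<p. 2 ^ (p - Suc i) * of_bool (c i = v))"

lemma col_weight_ge: "i < p \<Longrightarrow> c i = v \<Longrightarrow> 2 ^ (p - Suc i) \<le> col_weight p c v"
  unfolding col_weight_def
  by (rule order_trans[OF _ member_le_sum[of i]]) auto

lemma col_weight_less:
  assumes "\<And>k. k < i \<Longrightarrow> c k \<noteq> v" "i \<le> p"
  shows "col_weight p c v < 2 ^ (p - i)"
proof -
  have "col_weight p c v = (\<Sum>k\<in>{i..<p}. 2 ^ (p - Suc k) * of_bool (c k = v))"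
    unfolding col_weight_def using assms by (intro sum.mono_neutral_right) (auto, metis linorder_not_le)
  also have "\<dots> \<le> (\<Sum>k\<in>{i..<p}. 2 ^ (p - Suc k))"
    by (intro sum_mono) auto
  also have "\<dots> = (\<Sum>m<p - i. 2 ^ m)"
    by (rule sum.reindex_bij_witness[of _ "\<lambda>m. p - Suc m" "\<lambda>k. p - Suc k"]) (use assms(2) in auto)
  also have "\<dots> < 2 ^ (p - i)" by (simp add: geometric_sum)
  finally show ?thesis .
qed

text \<open>If row \<open>i\<close> jumps to a column \<open>Suc v\<close> above the height, column
  \<open>v\<close> has no 1 up to row \<open>i\<close> and is lighter. Conversely, when
  \<open>Suc v\<close> is first used, the height exceeds \<open>v\<close>, so column
  \<open>v\<close> has an earlier 1, which outweighs everything below it.\<close>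

lemma lex_iff_restricted_growth:
  assumes "\<And>i. i < p \<Longrightarrow> c i < q"
  shows "(\<forall>v. Suc v < q \<longrightarrow> col_weight p c (Suc v) \<le> col_weight p c v) \<longleftrightarrow>
    (\<forall>i<p. c i \<le> height c i)"
proof (intro iffI allI impI)
  fix i assume lex: "\<forall>v. Suc v < q \<longrightarrow> col_weight p c (Suc v) \<le> col_weight p c v" and i: "i < p"
  show "c i \<le> height c i"
  proof (rule ccontr)
    assume "\<not> c i \<le> height c i"
    then obtain v where v: "c i = Suc v" "height c i \<le> v"
      by (cases "c i") auto
    have "c k \<noteq> v" if "k < Suc i" for k
      using that v height_gt[of k i c] by (auto simp: less_Suc_eq)
    then have "col_weight p c v < 2 ^ (p - Suc i)" using i by (intro col_weight_less) auto
    also have "\<dots> \<le> col_weight p c (Suc v)" using v i by (intro col_weight_ge) auto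
    finally show False using lex assms[OF i] v by fastforce
  qed
next
  fix v assume rg: "\<forall>i<p. c i \<le> height c i" and v: "Suc v < q"
  show "col_weight p c (Suc v) \<le> col_weight p c v"
  proof (cases "\<exists>i<p. c i = Suc v")
    case False
    then have "col_weight p c (Suc v) = 0" by (auto simp: col_weight_def)
    then show ?thesis by (auto simp: col_weight_def intro!: sum_nonneg)
  next
    case True
    define i where "i = (LEAST i. i < p \<and> c i = Suc v)"
    have i: "i < p" "c i = Suc v" using LeastI_ex[OF True] by (auto simp: i_def)
    have first: "c k \<noteq> Suc v" if "k < i" for k
      using that i(1) not_less_Least[of k "\<lambda>i. i < p \<and> c i = Suc v"] by (auto simp: i_def)
    have "v < height c i" using rg i by fastforce
    then obtain k where k: "k < i" "c k = v" using height_attained[of i c v] rg i(1) by auto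
    have "col_weight p c (Suc v) < 2 ^ (p - i)" using first i by (intro col_weight_less) auto
    also have "\<dots> \<le> 2 ^ (p - Suc k)" using k i by (intro power_increasing) auto
    also have "\<dots> \<le> col_weight p c v" using k i by (intro col_weight_ge) auto
    finally show ?thesis by simp
  qed
qed

section \<open>0/1-points of the face as restricted growth sequences\<close>

definition growth_choice :: "nat \<Rightarrow> (nat \<Rightarrow> nat \<Rightarrow> bool) \<Rightarrow> (nat \<Rightarrow> nat) \<Rightarrow> bool" where
  "growth_choice p avail c \<longleftrightarrow> (\<forall>i<p. avail i (c i) \<and> c i \<le> height c i)"

text \<open>For \<open>I0\<close> inside the triangle, all cells above the diagonal count as
  available; the growth condition excludes them by \<open>height_le\<close>.\<close>

definition available :: "nat \<Rightarrow> (nat \<times> nat) set \<Rightarrow> nat \<Rightarrow> nat \<Rightarrow> bool" where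
  "available q I0 i j \<longleftrightarrow> j < q \<and> (Suc i, Suc j) \<notin> I0"

lemma sum_eq_col_weight:
  assumes "\<And>i. i < p \<Longrightarrow> entry x (Suc i) (Suc v) = of_bool (c i = v)"
  shows "(\<Sum>i=1..p. 2 ^ (p - i) * entry x i (Suc v)) = col_weight p c v"
  unfolding col_weight_def
  using sum.shift_bounds_Suc_ivl[of "\<lambda>i. 2 ^ (p - i) * entry x i (Suc v)" 0 p] assms
  by (simp add: atLeastLessThanSuc_atLeastAtMost lessThan_atLeast0)

lemma lex_partition_matrices_imp_choice:
  assumes x: "x \<in> lex_partition_matrices p q"
  obtains c where "\<And>i. i < p \<Longrightarrow> c i < q" "\<And>i. i < p \<Longrightarrow> c i \<le> height c i"
    "\<And>i j. i < p \<Longrightarrow> j < q \<Longrightarrow> entry x (Suc i) (Suc j) = of_bool (c i = j)"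
proof -
  define c where "c i = (THE j. j < q \<and> entry x (Suc i) (Suc j) = 1)" for i
  have ex1: "\<exists>!j. j < q \<and> entry x (Suc i) (Suc j) = 1" if "i < p" for i
  proof -
    have "\<exists>!j. j \<in> {1..q} \<and> entry x (Suc i) j = 1"
      using x that unfolding lex_partition_matrices_def by simp
    then obtain j where j: "j \<in> {1..q}" "entry x (Suc i) j = 1"
      and uniq: "\<And>k. k \<in> {1..q} \<Longrightarrow> entry x (Suc i) k = 1 \<Longrightarrow> k = j" by blast
    show ?thesis
    proof (rule ex1I[of _ "j - 1"])
      show "j - 1 < q \<and> entry x (Suc i) (Suc (j - 1)) = 1" using j by auto
      show "k = j - 1" if "k < q \<and> entry x (Suc i) (Suc k) = 1" for k
        using uniq[of "Suc k"] that by auto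
    qed
  qed
  have c: "c i < q" "entry x (Suc i) (Suc (c i)) = 1" if "i < p" for i
    using theI'[OF ex1[OF that]] by (auto simp: c_def)
  have ent: "entry x (Suc i) (Suc j) = of_bool (c i = j)" if "i < p" "j < q" for i j
  proof -
    have "entry x (Suc i) (Suc j) \<in> {0, 1}" using x that unfolding lex_partition_matrices_def by simp
    then show ?thesis using ex1[OF that(1)] c[OF that(1)] that(2) by auto
  qed
  have "col_weight p c (Suc v) \<le> col_weight p c v" if "Suc v < q" for v
  proof -
    have "\<forall>j\<in>{1..q - 1}. (\<Sum>i=1..p. 2 ^ (p - i) * entry x i j)
        \<ge> (\<Sum>i=1..p. 2 ^ (p - i) * entry x i (j + 1))"
      using x unfolding lex_partition_matrices_def by blast
    from bspec[OF this, of "Suc v"] that show ?thesis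
      using sum_eq_col_weight[of p x v c] sum_eq_col_weight[of p x "Suc v" c] ent by auto
  qed
  then have "\<And>i. i < p \<Longrightarrow> c i \<le> height c i"
    using lex_iff_restricted_growth[of p c q] c(1) by blast
  then show ?thesis using that c(1) ent by blast
qed

lemma choice_imp_lex_partition_matrices:
  assumes c: "\<And>i. i < p \<Longrightarrow> c i < q" "\<And>i. i < p \<Longrightarrow> c i \<le> height c i"
  obtains x where "x \<in> lex_partition_matrices p q"
    "\<And>i j. i < p \<Longrightarrow> j < q \<Longrightarrow> entry x (Suc i) (Suc j) = of_bool (c i = j)"
proof -
  define D where "D = (\<lambda>i. (Suc i, Suc (c i))) ` {..<p}"
  have "{k. (of_bool (k \<in> D) :: real) \<noteq> 0} = D" by auto
  then have fin: "finite {k. (of_bool (k \<in> D) :: real) \<noteq> 0}" by (simp add: D_def)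
  define x :: point where "x = Abs_poly_mapping (\<lambda>k. of_bool (k \<in> D))"
  have x: "Poly_Mapping.lookup x k = of_bool (k \<in> D)" for k
    unfolding x_def by (rule fun_cong[OF lookup_Abs_poly_mapping[OF fin]])
  have ent: "entry x (Suc i) (Suc j) = of_bool (c i = j)" if "i < p" for i j
    using that by (auto simp: x D_def)
  have "x \<in> lex_partition_matrices p q"
    unfolding lex_partition_matrices_def mem_Collect_eq
  proof (intro conjI ballI)
    show "Poly_Mapping.keys x \<subseteq> {1..p} \<times> {1..q}"
      using c by (auto simp: in_keys_iff x D_def Suc_le_eq)
    show "entry x i j \<in> {0, 1}" for i j by (simp add: x)
    show "\<exists>!j. j \<in> {1..q} \<and> entry x i j = 1" if "i \<in> {1..p}" for i
    proof -
      obtain k where k: "i = Suc k" "k < p" using \<open>i \<in> {1..p}\<close> by (cases i) auto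
      show ?thesis
        by (rule ex1I[of _ "Suc (c k)"]) (use c(1)[OF k(2)] k in \<open>auto simp: x D_def\<close>)
    qed
    show "(\<Sum>i=1..p. 2 ^ (p - i) * entry x i (j + 1)) \<le> (\<Sum>i=1..p. 2 ^ (p - i) * entry x i j)"
      if "j \<in> {1..q - 1}" for j
    proof -
      obtain v where v: "j = Suc v" "Suc v < q"
        using \<open>j \<in> {1..q - 1}\<close> by (cases j) auto
      have "col_weight p c (Suc v) \<le> col_weight p c v"
        using lex_iff_restricted_growth[of p c q] c v by blast
      then show ?thesis
        using sum_eq_col_weight[of p x v c] sum_eq_col_weight[of p x "Suc v" c] ent v by auto
    qed
  qed
  then show ?thesis using that ent by blast
qed

text \<open>By (P2), the entries prescribed by \<open>I1\<close> follow from those prescribed by \<open>I0\<close>, so \<open>I1\<close> drops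
  out on the right-hand sides.\<close>

lemma fixed_to_eq:
  fixes p q I0 I1
  defines "F \<equiv> cube_face p q I0 I1" and "P \<equiv> partitioning_orbitope p q"
  assumes I: "I0 \<subseteq> indices p q" "I1 \<subseteq> indices p q" and P2: "P2 q I0 I1"
  shows "binary_points p q (P \<inter> F) = {} \<longleftrightarrow> \<not> (\<exists>c. growth_choice p (available q I0) c)"
    and "i < p \<Longrightarrow> j < q \<Longrightarrow> (Suc i, Suc j) \<in> fixed_to 0 p q F P \<longleftrightarrow>
      j \<le> i \<and> \<not> (\<exists>c. growth_choice p (available q I0) c \<and> c i = j)"
    and "i < p \<Longrightarrow> j < q \<Longrightarrow> (Suc i, Suc j) \<in> fixed_to 1 p q F P \<longleftrightarrow>
      j \<le> i \<and> (\<forall>c. growth_choice p (available q I0) c \<longrightarrow> c i = j)"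
proof -
  let ?S = "binary_points p q (P \<inter> F)"
  have S: "?S = {x \<in> lex_partition_matrices p q.
      (\<forall>(i, j)\<in>I0. entry x i j = 0) \<and> (\<forall>(i, j)\<in>I1. entry x i j = 1)}"
    unfolding P_def F_def by (rule binary_points_orbitope)
  have to_c: "\<exists>c. growth_choice p (available q I0) c \<and>
      (\<forall>i<p. \<forall>j<q. entry x (Suc i) (Suc j) = of_bool (c i = j))" if x: "x \<in> ?S" for x
  proof -
    have "x \<in> lex_partition_matrices p q" using x S by blast
    then obtain c where c: "\<And>i. i < p \<Longrightarrow> c i < q" "\<And>i. i < p \<Longrightarrow> c i \<le> height c i"
      "\<And>i j. i < p \<Longrightarrow> j < q \<Longrightarrow> entry x (Suc i) (Suc j) = of_bool (c i = j)"
      using lex_partition_matrices_imp_choice by blast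
    have "(Suc i, Suc (c i)) \<notin> I0" if "i < p" for i
      using that c(1)[OF that] c(3)[OF that c(1)[OF that]] x S by auto
    then show ?thesis using c unfolding growth_choice_def available_def by blast
  qed
  have of_c: "\<exists>x\<in>?S. \<forall>i<p. \<forall>j<q. entry x (Suc i) (Suc j) = of_bool (c i = j)"
    if gc: "growth_choice p (available q I0) c" for c
  proof -
    have c: "\<And>i. i < p \<Longrightarrow> c i < q" "\<And>i. i < p \<Longrightarrow> c i \<le> height c i"
      "\<And>i. i < p \<Longrightarrow> (Suc i, Suc (c i)) \<notin> I0"
      using gc by (auto simp: growth_choice_def available_def)
    obtain x where x: "x \<in> lex_partition_matrices p q"
      and ent: "\<And>i j. i < p \<Longrightarrow> j < q \<Longrightarrow> entry x (Suc i) (Suc j) = of_bool (c i = j)"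
      using choice_imp_lex_partition_matrices[OF c(1,2)] by blast
    have "entry x i j = 0" if "(i, j) \<in> I0" for i j
    proof -
      obtain i' j' where "i = Suc i'" "j = Suc j'" "i' < p" "j' < q"
        using \<open>(i, j) \<in> I0\<close> I(1) by (cases i; cases j) (auto simp: indices_def)
      then show ?thesis using ent[of i' j'] c(3)[of i'] that by auto
    qed
    moreover have "entry x i j = 1" if "(i, j) \<in> I1" for i j
    proof -
      obtain i' j' where ij: "i = Suc i'" "j = Suc j'" "i' < p" "j' < q"
        using \<open>(i, j) \<in> I1\<close> I(2) by (cases i; cases j) (auto simp: indices_def)
      \<comment> \<open>(P2) speaks only about cells of the triangular row, so the chosen column is
        first placed there. All its cells except \<open>j\<close> lie in \<open>I0\<close>, hence
        the chosen one is \<open>j\<close>.\<close>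
      have "height c i' \<le> i'" using height_le[of i' c] c(2) ij(3) by simp
      then have "Suc (c i') \<in> {1..row_len q i}"
        using c(1)[OF ij(3)] c(2)[OF ij(3)] ij(1) by (auto simp: row_len_def)
      then have "Suc (c i') = j" using P2 that c(3)[OF ij(3)] ij(1) unfolding P2_def by blast
      then show ?thesis using ent ij by auto
    qed
    ultimately show ?thesis using x ent S by blast
  qed
  show "?S = {} \<longleftrightarrow> \<not> (\<exists>c. growth_choice p (available q I0) c)"
    using to_c of_c by blast
  assume ij: "i < p" "j < q"
  then have ind: "(Suc i, Suc j) \<in> indices p q \<longleftrightarrow> j \<le> i" by (auto simp: indices_def)
  show "(Suc i, Suc j) \<in> fixed_to 0 p q F P \<longleftrightarrow>
      j \<le> i \<and> \<not> (\<exists>c. growth_choice p (available q I0) c \<and> c i = j)"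
    unfolding fixed_to_def using ind ij to_c of_c by fastforce
  show "(Suc i, Suc j) \<in> fixed_to 1 p q F P \<longleftrightarrow>
      j \<le> i \<and> (\<forall>c. growth_choice p (available q I0) c \<longrightarrow> c i = j)"
    unfolding fixed_to_def using ind ij to_c of_c by fastforce
qed


section \<open>The two greedy bounds\<close>

text \<open>\<open>high i\<close> is the largest height that the rows before \<open>i\<close> can reach; \<open>low i\<close> is the smallest
  height at row \<open>i\<close> from which the remaining rows can be completed. Larger heights leave more
  freedom, so these two numbers describe all heights that matter.\<close>

locale row_choices =
  fixes p q :: nat and avail :: "nat \<Rightarrow> nat \<Rightarrow> bool"
  assumes avail_less: "avail i j \<Longrightarrow> j < q"
    and avail_ex: "i < p \<Longrightarrow> \<exists>j. avail i j"
begin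

definition least :: "nat \<Rightarrow> nat" where
  "least i = (LEAST j. avail i j)"

text \<open>Recursion on the number \<open>n\<close> of remaining rows. The height rises by at most
  one per row, so starting below \<open>b\<close> is possible only at \<open>b - 1\<close> by
  opening column \<open>b - 1\<close>. Otherwise the height must already be \<open>b\<close> and
  admit the smallest available column.\<close>

primrec low_from_end :: "nat \<Rightarrow> nat" where
  "low_from_end 0 = 0"
| "low_from_end (Suc n) = (let b = low_from_end n; i = p - Suc n in
     if 0 < b \<and> avail i (b - 1) then b - 1 else max b (least i))"

definition low :: "nat \<Rightarrow> nat" where
  "low i = low_from_end (p - i)"

primrec high :: "nat \<Rightarrow> nat" where
  "high 0 = 0"
| "high (Suc i) = (if avail i (high i) then Suc (high i) else high i)"

text \<open>The disjunct \<open>j = high i\<close> carries no bound: it leads to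
  \<open>high (Suc i)\<close>, which can be completed by \<open>low_le_high\<close> if
  \<open>low 0 = 0\<close>.\<close>

definition usable :: "nat \<Rightarrow> nat \<Rightarrow> bool" where
  "usable i j \<longleftrightarrow> avail i j \<and> j \<le> high i \<and> (j = high i \<or> low (Suc i) \<le> high i)"

lemma avail_least: "i < p \<Longrightarrow> avail i (least i)"
  unfolding least_def by (rule LeastI_ex) (rule avail_ex)

lemma least_le: "avail i j \<Longrightarrow> least i \<le> j"
  unfolding least_def by (rule Least_le)

lemma low_end [simp]: "low p = 0"
  by (simp add: low_def)

lemma low_step:
  assumes "i < p"
  shows "low i = (if 0 < low (Suc i) \<and> avail i (low (Suc i) - 1) then low (Suc i) - 1
                  else max (low (Suc i)) (least i))"
proof -
  have "p - i = Suc (p - Suc i)" "p - Suc (p - Suc i) = i" using assms by auto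
  then show ?thesis by (simp add: low_def Let_def)
qed

lemma low_le: "i \<le> p \<Longrightarrow> low i \<le> q"
proof (induction rule: inc_induct)
  case (step i)
  then show ?case using low_step[of i] avail_less[OF avail_least[of i]] by auto
qed simp

lemma high_le: "high i \<le> i"
  by (induction i) auto

lemma high_le_width: "high i \<le> q"
  using avail_less by (induction i) (auto simp: Suc_le_eq)

lemma least_le_low: "i < p \<Longrightarrow> least i \<le> low i"
  using low_step[of i] least_le[of i "low (Suc i) - 1"] by auto

lemma height_bounds:
  assumes c: "growth_choice p avail c" and i: "i \<le> p"
  shows "low i \<le> height c i" and "height c i \<le> high i"
proof -
  show "low i \<le> height c i" using i
  proof (induction rule: inc_induct)
    case (step i)
    have "avail i (c i)" "c i \<le> height c i" using c step(1,2) by (auto simp: growth_choice_def)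
    moreover have "least i \<le> c i" using calculation least_le by blast
    \<comment> \<open>Unless \<open>low (Suc i) = Suc (c i)\<close>, the height before row
      \<open>i\<close> already reaches \<open>low (Suc i)\<close>.\<close>
    ultimately show ?case using step(3) low_step[of i] step(1,2)
      by (cases "low (Suc i) = Suc (c i)") (auto split: if_splits)
  qed simp
  show "height c i \<le> high i" using i
  proof (induction i)
    case (Suc i)
    have "avail i (c i)" "c i \<le> height c i" "height c i \<le> high i"
      using c Suc by (auto simp: growth_choice_def)
    then show ?case by (cases "c i = high i") auto
  qed simp
qed

lemma growth_choice_usable:
  assumes c: "growth_choice p avail c" and i: "i < p"
  shows "usable i (c i)"
proof -
  have "avail i (c i)" "c i \<le> height c i" using assms by (auto simp: growth_choice_def)
  moreover have "height c i \<le> high i" "low (Suc i) \<le> height c (Suc i)"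
    using height_bounds(2)[OF c, of i] height_bounds(1)[OF c, of "Suc i"] i by (simp_all del: height.simps)
  ultimately show ?thesis by (auto simp: usable_def)
qed

text \<open>If \<open>low (Suc i)\<close> exceeds \<open>high i\<close>, and hence
  \<open>low i\<close>, the first branch of \<open>low_step\<close> applies. Then
  \<open>low (Suc i) = Suc (high i)\<close> and column \<open>high i\<close> is available, so
  \<open>high\<close> rises too.\<close>

lemma low_le_high:
  assumes "low 0 = 0" "i \<le> p"
  shows "low i \<le> high i"
  using assms(2)
proof (induction i)
  case (Suc i)
  then have IH: "low i \<le> high i" and i: "i < p" by auto
  show ?case
  proof (cases "low (Suc i) \<le> high i")
    case False
    then have "low (Suc i) - 1 \<le> high i" and av: "avail i (low (Suc i) - 1)"
      using IH low_step[OF i] by (auto split: if_splits)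
    then have "low (Suc i) = Suc (high i)" using False by simp
    then have "low (Suc i) = Suc (high i) \<and> avail i (high i)" using av by simp
    then show ?thesis by simp
  qed auto
qed (use assms(1) in simp)

text \<open>Greedy completion, forced to use column \<open>j\<close> in row \<open>r\<close>; no row is forced if \<open>r = p\<close>.\<close>

primrec greedy_height :: "nat \<Rightarrow> nat \<Rightarrow> nat \<Rightarrow> nat" where
  "greedy_height r j 0 = 0"
| "greedy_height r j (Suc i) = (let m = greedy_height r j i in
     max m (Suc (if i = r then j else if avail i m then m else least i)))"

definition greedy_choice :: "nat \<Rightarrow> nat \<Rightarrow> nat \<Rightarrow> nat" where
  "greedy_choice r j i = (let m = greedy_height r j i in
     if i = r then j else if avail i m then m else least i)"

text \<open>Choices and heights depend on each other; the recursion runs over heights alone, and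
  this lemma identifies them with the heights of the choices.\<close>

lemma height_greedy_choice: "height (greedy_choice r j) i = greedy_height r j i"
  by (induction i) (auto simp: greedy_choice_def Let_def)

text \<open>Up to row \<open>r\<close> the greedy height is \<open>high\<close>; usability of
  \<open>j\<close> keeps it at or above \<open>low\<close> across row \<open>r\<close>, and greedy
  steps preserve this. Since \<open>least i \<le> low i\<close>, the fallback column always
  fits.\<close>

lemma growth_choice_greedy:
  assumes feasible: "low 0 = 0" and r: "r < p \<Longrightarrow> usable r j"
  shows "growth_choice p avail (greedy_choice r j)"
proof -
  have before: "greedy_height r j i = high i" if "i \<le> p" "i \<le> r" for i
    using that
  proof (induction i)
    case (Suc i)
    then have eq: "greedy_height r j i = high i" and i: "i < p" "i < r" by auto
    have "least i \<le> high i" using least_le_low[OF i(1)] low_le_high[OF feasible, of i] i by simp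
    moreover have "avail i (least i)" using avail_least i by blast
    \<comment> \<open>The fallback column lies strictly below the height and leaves it
      unchanged.\<close>
    ultimately have "\<not> avail i (high i) \<Longrightarrow> Suc (least i) \<le> high i"
      by (metis Suc_leI le_neq_implies_less)
    then show ?case using eq i by (auto simp: Let_def)
  qed simp
  have low: "low i \<le> greedy_height r j i" if "i \<le> p" for i
    using that
  proof (induction i)
    case (Suc i)
    then have IH: "low i \<le> greedy_height r j i" and i: "i < p" by auto
    show ?case
    proof (cases "i = r")
      case True
      then show ?thesis using before[of i] i r low_le_high[OF feasible, of "Suc i"]
        by (auto simp: usable_def Let_def split: if_splits)
    next
      case False
      then show ?thesis using IH low_step[OF i]
        by (cases "low (Suc i) - 1 = greedy_height r j i") (auto simp: Let_def split: if_splits)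
    qed
  qed (use feasible in simp)
  show ?thesis unfolding growth_choice_def
  proof (intro allI impI)
    fix i assume i: "i < p"
    show "avail i (greedy_choice r j i) \<and> greedy_choice r j i \<le> height (greedy_choice r j) i"
      unfolding height_greedy_choice
      using before[of i] low[of i] i r avail_least[OF i] least_le_low[OF i]
      by (auto simp: greedy_choice_def Let_def usable_def)
  qed
qed

lemma growth_choice_ex: "(\<exists>c. growth_choice p avail c) \<longleftrightarrow> low 0 = 0"
  using growth_choice_greedy[of p] height_bounds(1)[of _ 0] by auto

lemma usable_iff:
  assumes "low 0 = 0" "i < p"
  shows "(\<exists>c. growth_choice p avail c \<and> c i = j) \<longleftrightarrow> usable i j"
proof
  assume "usable i j"
  then have "growth_choice p avail (greedy_choice i j)" using assms by (intro growth_choice_greedy)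
  moreover have "greedy_choice i j i = j" by (simp add: greedy_choice_def)
  ultimately show "\<exists>c. growth_choice p avail c \<and> c i = j" by blast
qed (use assms growth_choice_usable in blast)

text \<open>Feasibility supplies a usable column, so uniqueness becomes a singleton, which the
  program detects by counting.\<close>

lemma forced_iff:
  assumes "low 0 = 0" "i < p"
  shows "(\<forall>c. growth_choice p avail c \<longrightarrow> c i = j) \<longleftrightarrow> {k. usable i k} = {j}"
proof -
  have "(\<forall>c. growth_choice p avail c \<longrightarrow> c i = j) \<longleftrightarrow> (\<forall>k. usable i k \<longrightarrow> k = j)"
    using usable_iff[OF assms] by metis
  moreover have "\<exists>k. usable i k"
    using usable_iff[OF assms] growth_choice_ex assms(1) by metis
  ultimately show ?thesis by auto
qed

end

lemma row_choices_available:
  assumes I0: "I0 \<subseteq> indices p q" and q: "0 < q" and P1: "P1 p q I0"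
  shows "row_choices p q (available q I0)"
proof
  show "available q I0 i j \<Longrightarrow> j < q" for i j by (simp add: available_def)
  fix i assume i: "i < p"
  have "row q (Suc i) = Pair (Suc i) ` {1..row_len q (Suc i)}" by (auto simp: row_def)
  then have row: "finite (row q (Suc i))" "card (row q (Suc i)) = row_len q (Suc i)"
    by (simp_all add: card_image inj_on_def)
  have "card (I0 \<inter> row q (Suc i)) < row_len q (Suc i)"
  proof -
    have "card (I0 \<inter> row q (Suc i)) \<le> row_len q (Suc i) - 1"
      using P1 i by (auto simp: P1_def)
    moreover have "0 < row_len q (Suc i)" using q by (simp add: row_len_def)
    ultimately show ?thesis by linarith
  qed
  then have "I0 \<inter> row q (Suc i) \<noteq> row q (Suc i)" using row(2) by auto
  then obtain j where "j \<in> {1..row_len q (Suc i)}" "(Suc i, j) \<notin> I0"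
    by (auto simp: row_def)
  then show "\<exists>j. available q I0 i j"
    by (intro exI[of _ "j - 1"]) (auto simp: available_def row_len_def)
qed


section \<open>Total correctness with running time\<close>

text \<open>A stuck execution has no derivation, so existence covers both termination and the word
  bound.\<close>

definition runs :: "nat \<Rightarrow> com \<Rightarrow> state \<Rightarrow> nat \<Rightarrow> (state \<Rightarrow> bool) \<Rightarrow> bool" where
  "runs W c s T Q \<longleftrightarrow> (\<exists>t s'. exec W c s t s' \<and> t \<le> T \<and> Q s')"

lemma runs_weaken: "runs W c s T Q \<Longrightarrow> T \<le> T' \<Longrightarrow> (\<And>s. Q s \<Longrightarrow> Q' s) \<Longrightarrow> runs W c s T' Q'"
  unfolding runs_def by (meson order_trans)

lemma runs_elementary: "exec W c s 1 s' \<Longrightarrow> Q s' \<Longrightarrow> runs W c s (Suc 0) Q"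
  unfolding runs_def by (intro exI[of _ 1] exI[of _ s']) simp

lemma runs_Seq:
  assumes "runs W c1 s T1 R" "\<And>s'. R s' \<Longrightarrow> runs W c2 s' T2 Q"
  shows "runs W (Seq c1 c2) s (T1 + T2) Q"
  using assms unfolding runs_def by (meson add_mono exec.Seq)

lemma runs_Cond:
  assumes "holds b (fst s) \<Longrightarrow> runs W c1 s T Q" "\<not> holds b (fst s) \<Longrightarrow> runs W c2 s T Q"
  shows "runs W (Cond b c1 c2) s (Suc T) Q"
proof (cases "holds b (fst s)")
  case True
  then obtain t s' where "exec W c1 s t s'" "t \<le> T" "Q s'" using assms(1) by (auto simp: runs_def)
  then show ?thesis unfolding runs_def using exec.Cond_true[OF True, of W c1 t s' c2] by fastforce
next
  case False
  then obtain t s' where "exec W c2 s t s'" "t \<le> T" "Q s'" using assms(2) by (auto simp: runs_def)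
  then show ?thesis unfolding runs_def using exec.Cond_false[OF False, of W c2 t s' c1] by fastforce
qed

text \<open>Every loop of the program has a known iteration count, so the invariant is indexed by
  completed iterations. \<open>Suc T\<close> pays for test and body, the last 1 for the failing
  test.\<close>

lemma runs_While:
  assumes step: "\<And>k s. k < n \<Longrightarrow> I k s \<Longrightarrow> holds b (fst s) \<and> runs W c s T (I (Suc k))"
    and exit: "\<And>s. I n s \<Longrightarrow> \<not> holds b (fst s)"
    and init: "I 0 s"
  shows "runs W (While b c) s (n * Suc T + 1) (I n)"
proof -
  have "runs W (While b c) s ((n - k) * Suc T + 1) (I n)" if "k \<le> n" "I k s" for k s
    using that
  proof (induction arbitrary: s rule: inc_induct)
    case base
    then show ?case unfolding runs_def using exec.While_false[OF exit] by fastforce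
  next
    case (step k)
    have b: "holds b (fst s)" and "runs W c s T (I (Suc k))" using assms(1) step.prems step.hyps by auto
    then obtain t1 s1 where 1: "exec W c s t1 s1" "t1 \<le> T" "I (Suc k) s1" by (auto simp: runs_def)
    obtain t2 s2 where 2: "exec W (While b c) s1 t2 s2" "t2 \<le> (n - Suc k) * Suc T + 1" "I n s2"
      using step.IH[OF 1(3)] by (auto simp: runs_def)
    have "n - k = Suc (n - Suc k)" using step.hyps by auto
    then have "1 + t1 + t2 \<le> (n - k) * Suc T + 1" using 1 2 by simp
    then show ?case unfolding runs_def using exec.While_true[OF b 1(1) 2(1)] 2(3) by blast
  qed
  from this[of 0 s] init show ?thesis by simp
qed

text \<open>For loop-free code only: the value \<open>False\<close> at \<open>While\<close> leaves
  loops to \<open>runs_While\<close>.\<close>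

fun wp :: "nat \<Rightarrow> com \<Rightarrow> (state \<Rightarrow> bool) \<Rightarrow> state \<Rightarrow> bool" where
  "wp W Skip Q s = Q s"
| "wp W (Const x n) Q (r, m) = (n \<le> W \<and> Q (r(x := n), m))"
| "wp W (Add x y z) Q (r, m) = (r y + r z \<le> W \<and> Q (r(x := r y + r z), m))"
| "wp W (Sub x y z) Q (r, m) = (r y - r z \<le> W \<and> Q (r(x := r y - r z), m))"
| "wp W (Load x a y) Q (r, m) = (m a (r y) \<le> W \<and> Q (r(x := m a (r y)), m))"
| "wp W (Store a x y) Q (r, m) = (r y \<le> W \<and> Q (r, m(a := (m a)(r x := r y))))"
| "wp W (Seq c1 c2) Q s = wp W c1 (wp W c2 Q) s"
| "wp W (Cond b c1 c2) Q s = (if holds b (fst s) then wp W c1 Q s else wp W c2 Q s)"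
| "wp W (While b c) Q s = False"

fun straight_time :: "com \<Rightarrow> nat" where
  "straight_time (Seq c1 c2) = straight_time c1 + straight_time c2"
| "straight_time (Cond b c1 c2) = Suc (max (straight_time c1) (straight_time c2))"
| "straight_time _ = 1"

lemma runs_straight: "wp W c Q s \<Longrightarrow> runs W c s (straight_time c) Q"
proof (induction W c Q s rule: wp.induct)
  case (7 W c1 c2 Q s)
  have "runs W c1 s (straight_time c1) (wp W c2 Q)" using 7 by simp
  then show ?case unfolding straight_time.simps by (rule runs_Seq) (rule 7(1))
next
  case (8 W b c1 c2 Q s)
  have "runs W (Cond b c1 c2) s (Suc (max (straight_time c1) (straight_time c2))) Q"
    by (rule runs_Cond) (use 8 in \<open>auto intro: runs_weaken\<close>)
  then show ?case by simp
qed (auto intro: runs_elementary[OF exec.Skip] runs_elementary[OF exec.Const]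
    runs_elementary[OF exec.Add] runs_elementary[OF exec.Sub]
    runs_elementary[OF exec.Load] runs_elementary[OF exec.Store])

lemma runs_straight_le: "straight_time c \<le> T \<Longrightarrow> wp W c Q s \<Longrightarrow> runs W c s T Q"
  using runs_straight runs_weaken by blast

section \<open>The program\<close>

text \<open>Registers: 2 holds 1, 3 holds 0, 4 the row, 5 the address of its first cell, 6 the column,
  7 \<open>low\<close> (backward pass) or \<open>high\<close> (forward pass), 8 an address and 9 its content; array 4
  stores \<open>low (Suc i)\<close> at address \<open>i\<close>.\<close>

fun seqs :: "com list \<Rightarrow> com" where
  "seqs [] = Skip"
| "seqs [c] = c"
| "seqs (c # cs) = Seq c (seqs cs)"

definition find_least :: com where
  "find_least = While (Equal 9 2) (seqs [Add 6 6 2, Add 8 8 2, Load 9 0 8])"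

definition backward_start :: com where
  "backward_start = seqs [Sub 4 4 2, Sub 5 5 1, Store 4 4 7, Add 6 3 3, Add 8 5 3, Load 9 0 8]"

definition backward_end :: com where
  "backward_end = seqs [
     Cond (Less 3 7) (seqs [Sub 10 7 2, Add 8 5 10, Load 9 0 8]) (Add 9 2 3),
     Cond (Equal 9 3) (Sub 7 7 2) (Cond (Less 7 6) (Add 7 6 3) Skip)]"

definition backward_pass :: com where
  "backward_pass = While (Less 3 4) (seqs [backward_start, find_least, backward_end])"

text \<open>Register 10 holds \<open>low (Suc i)\<close>, 11 the first column that is not too small, 13 the number of
  cells of the row in the index set, 14 the number of usable cells seen, 15 the last one.\<close>

definition forward_start :: com where
  "forward_start = seqs [Load 10 4 4, Cond (Less 7 10) (Add 11 7 3) (Add 11 3 3),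
     Add 13 4 2, Cond (Less 1 13) (Add 13 1 3) Skip, Add 6 3 3, Add 8 5 3, Add 14 3 3]"

text \<open>The value written is 1 for cells that are not usable. The loop stops at the diagonal, so
  cells above it keep their initial 0 and belong to neither output set.\<close>

definition mark_row :: com where
  "mark_row = While (Less 6 13) (seqs [Load 9 0 8,
     Cond (Less 6 11) (Add 9 2 3) Skip, Cond (Less 7 6) (Add 9 2 3) Skip, Store 2 8 9,
     Cond (Equal 9 3) (seqs [Add 14 14 2, Add 15 8 3]) Skip, Add 6 6 2, Add 8 8 2])"

text \<open>The guard \<open>Less 7 1\<close> matters when all \<open>q\<close> columns are open:
  the address would then be the first cell of the next row.\<close>

definition forward_end :: com where
  "forward_end = seqs [Cond (Equal 14 2) (Store 3 15 2) Skip,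
     Cond (Less 7 1) (seqs [Add 8 5 7, Load 9 0 8, Cond (Equal 9 3) (Add 7 7 2) Skip]) Skip,
     Add 4 4 2, Add 5 5 1]"

definition forward_pass :: com where
  "forward_pass = While (Less 4 0) (seqs [forward_start, mark_row, forward_end])"

text \<open>Without multiplication, the first loop builds \<open>p * q\<close> by \<open>p\<close>
  additions and leaves registers 4 and 5 where the backward pass starts.\<close>

definition fixing :: com where
  "fixing = seqs [Const 2 1, While (Less 4 0) (seqs [Add 4 4 2, Add 5 5 1]), backward_pass,
     Cond (Less 3 7) (Const 0 0) (Seq forward_pass (Const 0 1))]"

section \<open>Correctness and cost of the program\<close>

lemma address_eq_iff:
  "j < q \<Longrightarrow> l < q \<Longrightarrow> i * q + j = k * q + l \<longleftrightarrow> i = k \<and> j = (l :: nat)"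
  by (metis add.commute div_mult_self1 div_less add_0 less_zeroE mod_less mod_mult_self1 gr_implies_not0)

lemma address_less: "i < p \<Longrightarrow> j < q \<Longrightarrow> i * q + j < p * (q :: nat)"
  by (metis add_mult_distrib Suc_leI add_less_cancel_left less_le_trans mult_le_mono1 mult_Suc add.commute)

text \<open>\<open>A\<close> is the content of array 0. The factor 2 in \<open>word\<close> leaves
  room for a further row beyond the last address.\<close>

locale fixing_run = row_choices p q avail for p q and avail :: "nat \<Rightarrow> nat \<Rightarrow> bool" +
  fixes W :: nat and A :: "nat \<Rightarrow> nat"
  assumes size: "2 \<le> q" "q \<le> p" and word: "2 * (p * q) \<le> W"
    and A: "\<And>i j. i < p \<Longrightarrow> j < q \<Longrightarrow> A (i * q + j) = of_bool (\<not> avail i j)"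
    and A_le: "\<And>k. A k \<le> 1"
begin

lemma word_bounds: "p + q \<le> W" "i < p \<Longrightarrow> i * q + q + q \<le> W"
proof -
  have pq: "p \<le> p * q" "q \<le> p * q" using size by simp_all
  then show "p + q \<le> W" using word by linarith
  show "i * q + q + q \<le> W" if "i < p"
    using mult_le_mono1[of "Suc i" p q] that pq word by (simp add: add.commute)
qed

definition frame :: "state \<Rightarrow> bool" where
  "frame s \<longleftrightarrow> fst s 0 = p \<and> fst s 1 = q \<and> fst s 2 = 1 \<and> fst s 3 = 0 \<and> snd s 0 = A"

definition backward_inv :: "nat \<Rightarrow> state \<Rightarrow> bool" where
  "backward_inv i s \<longleftrightarrow> frame s \<and> fst s 4 = i \<and> fst s 5 = i * q \<and> fst s 7 = low i \<and>
     snd s 2 = (\<lambda>_. 0) \<and> snd s 3 = (\<lambda>_. 0) \<and> (\<forall>k. i \<le> k \<and> k < p \<longrightarrow> snd s 4 k = low (Suc k))"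

definition scan_inv :: "nat \<Rightarrow> nat \<Rightarrow> state \<Rightarrow> bool" where
  "scan_inv i j s \<longleftrightarrow> frame s \<and> fst s 4 = i \<and> fst s 5 = i * q \<and> fst s 7 = low (Suc i) \<and>
     snd s 2 = (\<lambda>_. 0) \<and> snd s 3 = (\<lambda>_. 0) \<and> (\<forall>k. i \<le> k \<and> k < p \<longrightarrow> snd s 4 k = low (Suc k)) \<and>
     fst s 6 = j \<and> fst s 8 = i * q + j \<and> fst s 9 = A (i * q + j)"

lemma runs_backward_start:
  assumes i: "i < p" and inv: "backward_inv (Suc i) s"
  shows "runs W backward_start s 6 (scan_inv i 0)"
proof (rule runs_straight_le)
  obtain r m where s: "s = (r, m)" by (cases s)
  show "wp W backward_start (scan_inv i 0) s"
    using inv size word_bounds(1) word_bounds(2)[OF i] low_le[of "Suc i"] i A_le[of "i * q"]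
    by (auto simp: s backward_start_def backward_inv_def scan_inv_def frame_def)
qed (simp add: backward_start_def)

lemma runs_find_least:
  assumes i: "i < p" and inv: "scan_inv i 0 s"
  shows "runs W find_least s (q * 4 + 1) (scan_inv i (least i))"
proof -
  have lq: "least i < q" using avail_less[OF avail_least[OF i]] .
  have "runs W find_least s (least i * Suc 3 + 1) (scan_inv i (least i))"
    unfolding find_least_def
  proof (rule runs_While[where I = "scan_inv i"])
    fix k and s :: state assume k: "k < least i" and I: "scan_inv i k s"
    obtain r m where s: "s = (r, m)" by (cases s)
    have "\<not> avail i k" using least_le[of i k] k by auto
    then have "A (i * q + k) = 1" using A[OF i, of k] k lq by simp
    then have "holds (Equal 9 2) (fst s)" using I by (simp add: scan_inv_def frame_def)
    moreover have "runs W (seqs [Add 6 6 2, Add 8 8 2, Load 9 0 8]) s 3 (scan_inv i (Suc k))"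
      by (rule runs_straight_le)
        (use I k lq size word_bounds(1) word_bounds(2)[OF i] A_le[of "Suc (i * q + k)"]
          in \<open>auto simp: s scan_inv_def frame_def\<close>)
    ultimately show "holds (Equal 9 2) (fst s) \<and>
        runs W (seqs [Add 6 6 2, Add 8 8 2, Load 9 0 8]) s 3 (scan_inv i (Suc k))" ..
  next
    fix s :: state assume I: "scan_inv i (least i) s"
    have "A (i * q + least i) = 0" using A[OF i lq] avail_least[OF i] by simp
    then show "\<not> holds (Equal 9 2) (fst s)" using I by (simp add: scan_inv_def frame_def)
  qed (rule inv)
  then show ?thesis by (rule runs_weaken) (use lq in auto)
qed

lemma runs_backward_end:
  assumes i: "i < p" and inv: "scan_inv i (least i) s"
  shows "runs W backward_end s 8 (backward_inv i)"
proof (rule runs_straight_le)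
  obtain r m where s: "s = (r, m)" by (cases s)
  have lw: "low (Suc i) \<le> q" using low_le i by simp
  have regs: "r 0 = p" "r (Suc 0) = q" "r 2 = Suc 0" "r 3 = 0" "r 4 = i" "r 5 = i * q"
      "r 6 = least i" "r 7 = low (Suc i)" "m 0 = A" "m 2 = (\<lambda>_. 0)" "m 3 = (\<lambda>_. 0)"
      "\<And>k. i \<le> k \<Longrightarrow> k < p \<Longrightarrow> m 4 k = low (Suc k)"
    using inv by (simp_all add: s scan_inv_def frame_def)
  have "least i < q" using avail_less[OF avail_least[OF i]] .
  note bounds = this lw size word_bounds(1) word_bounds(2)[OF i]
  show "wp W backward_end (backward_inv i) s"
  proof (cases "low (Suc i)")
    case 0
    then show ?thesis using bounds
      by (simp add: s backward_end_def backward_inv_def frame_def regs low_step[OF i])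
  next
    case (Suc l)
    then have "A (i * q + l) = of_bool (\<not> avail i l)" using A[OF i, of l] lw by simp
    then show ?thesis using bounds Suc
      by (cases "avail i l"; cases "low (Suc i) < least i")
        (simp_all add: s backward_end_def backward_inv_def frame_def regs low_step[OF i])
  qed
qed (simp add: backward_end_def)

lemma runs_backward_pass:
  assumes "backward_inv p s"
  shows "runs W backward_pass s (p * (q * 4 + 16) + 1) (backward_inv 0)"
proof -
  have "runs W backward_pass s (p * Suc (q * 4 + 15) + 1) (backward_inv (p - p))"
    unfolding backward_pass_def
  proof (rule runs_While[where I = "\<lambda>n. backward_inv (p - n)"])
    fix n and s :: state assume n: "n < p" and I: "backward_inv (p - n) s"
    define i where "i = p - Suc n"
    have i: "i < p" "p - n = Suc i" using n by (auto simp: i_def)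
    have "runs W (seqs [backward_start, find_least, backward_end]) s (6 + (q * 4 + 1 + 8)) (backward_inv i)"
      unfolding seqs.simps
      by (rule runs_Seq, rule runs_backward_start[OF i(1) I[unfolded i(2)]], rule runs_Seq,
        erule runs_find_least[OF i(1)], erule runs_backward_end[OF i(1)])
    then have "runs W (seqs [backward_start, find_least, backward_end]) s (q * 4 + 15) (backward_inv (p - Suc n))"
      by (rule runs_weaken) (simp_all add: i_def)
    moreover have "holds (Less 3 4) (fst s)" using I i by (simp add: backward_inv_def frame_def)
    ultimately show "holds (Less 3 4) (fst s) \<and>
        runs W (seqs [backward_start, find_least, backward_end]) s (q * 4 + 15) (backward_inv (p - Suc n))"
      by blast
  qed (use assms in \<open>auto simp: backward_inv_def frame_def\<close>)
  then show ?thesis by (rule runs_weaken) simp_all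
qed

text \<open>\<open>marked\<close> and \<open>forced\<close> describe arrays 2 and 3 after
  \<open>n\<close> finished rows, later rows being still 0; \<open>n = p\<close> gives the
  output.\<close>

definition marked :: "nat \<Rightarrow> nat \<Rightarrow> nat \<Rightarrow> nat" where
  "marked n i j = of_bool (i < n \<and> j \<le> i \<and> \<not> usable i j)"

definition forced :: "nat \<Rightarrow> nat \<Rightarrow> nat \<Rightarrow> nat" where
  "forced n i j = of_bool (i < n \<and> {k. usable i k} = {j})"

definition forward_frame :: "nat \<Rightarrow> state \<Rightarrow> bool" where
  "forward_frame i s \<longleftrightarrow> frame s \<and> fst s 4 = i \<and> fst s 5 = i * q \<and> fst s 7 = high i \<and>
     (\<forall>k<p. snd s 4 k = low (Suc k)) \<and>
     (\<forall>k j. j < q \<longrightarrow> snd s 3 (k * q + j) = forced i k j)"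

definition forward_inv :: "nat \<Rightarrow> state \<Rightarrow> bool" where
  "forward_inv i s \<longleftrightarrow> forward_frame i s \<and>
     (\<forall>k j. j < q \<longrightarrow> snd s 2 (k * q + j) = marked i k j)"

definition row_inv :: "nat \<Rightarrow> nat \<Rightarrow> state \<Rightarrow> bool" where
  "row_inv i n s \<longleftrightarrow> forward_frame i s \<and> fst s 6 = n \<and> fst s 8 = i * q + n \<and>
     fst s 11 = (if high i < low (Suc i) then high i else 0) \<and> fst s 13 = min q (Suc i) \<and>
     fst s 14 = card {j. j < n \<and> usable i j} \<and>
     (0 < fst s 14 \<longrightarrow> (\<exists>j<n. usable i j \<and> fst s 15 = i * q + j)) \<and>
     (\<forall>k j. j < q \<longrightarrow> snd s 2 (k * q + j) = (if k = i \<and> j < n then of_bool (\<not> usable i j) else marked i k j))"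

lemma runs_forward_start:
  assumes i: "i < p" and inv: "forward_inv i s"
  shows "runs W forward_start s 9 (row_inv i 0)"
proof (rule runs_straight_le)
  obtain r m where s: "s = (r, m)" by (cases s)
  show "wp W forward_start (row_inv i 0) s"
    using inv size word_bounds(1) word_bounds(2)[OF i] low_le[of "Suc i"] i high_le_width[of i]
    by (auto simp: s forward_start_def forward_inv_def row_inv_def forward_frame_def frame_def)
qed (simp add: forward_start_def)

text \<open>The disjunction becomes an interval test: if \<open>high i < low (Suc i)\<close>, both
  ends are \<open>high i\<close> and only that column survives.\<close>

lemma usable_iff_bounds:
  "usable i j \<longleftrightarrow> avail i j \<and> \<not> j < (if high i < low (Suc i) then high i else 0) \<and> \<not> high i < j"
  by (auto simp: usable_def)

lemma runs_mark_row:
  assumes i: "i < p" and inv: "row_inv i 0 s"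
  shows "runs W mark_row s (q * 13 + 1) (row_inv i (min q (Suc i)))"
proof -
  let ?body = "seqs [Load 9 0 8, Cond (Less 6 11) (Add 9 2 3) Skip, Cond (Less 7 6) (Add 9 2 3) Skip,
    Store 2 8 9, Cond (Equal 9 3) (seqs [Add 14 14 2, Add 15 8 3]) Skip, Add 6 6 2, Add 8 8 2]"
  have "runs W mark_row s (min q (Suc i) * Suc 12 + 1) (row_inv i (min q (Suc i)))"
    unfolding mark_row_def
  proof (rule runs_While[where I = "row_inv i"])
    fix n and s :: state assume n: "n < min q (Suc i)" and I: "row_inv i n s"
    obtain r m where s: "s = (r, m)" by (cases s)
    define lo where "lo = (if high i < low (Suc i) then high i else 0)"
    have regs: "r 0 = p" "r (Suc 0) = q" "r 2 = Suc 0" "r 3 = 0" "r 4 = i" "r 5 = i * q"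
        "r 6 = n" "r 7 = high i" "r 8 = i * q + n" "r 11 = lo" "r 13 = min q (Suc i)" "m 0 = A"
        "r 14 = card {j. j < n \<and> usable i j}"
      using I by (simp_all add: s row_inv_def forward_frame_def frame_def lo_def)
    have "card {j. j < n \<and> usable i j} \<le> n"
      using card_mono[of "{..<n}" "{j. j < n \<and> usable i j}"] by fastforce
    moreover have "A (i * q + n) = of_bool (\<not> avail i n)" using A i n by simp
    moreover have "usable i n \<longleftrightarrow> avail i n \<and> \<not> n < lo \<and> \<not> high i < n"
      unfolding lo_def by (rule usable_iff_bounds)
    \<comment> \<open>\<open>Q\<close> gives the effect of one iteration without quantifiers, so
      symbolic execution is separated from restoring the invariant.\<close>
    moreover define Q :: "state \<Rightarrow> bool" where "Q s' \<longleftrightarrow> frame s' \<and> fst s' 4 = i \<and> fst s' 5 = i * q \<and>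
        fst s' 6 = Suc n \<and> fst s' 7 = high i \<and> fst s' 8 = i * q + Suc n \<and> fst s' 11 = lo \<and>
        fst s' 13 = min q (Suc i) \<and> fst s' 14 = r 14 + of_bool (usable i n) \<and>
        fst s' 15 = (if usable i n then i * q + n else r 15) \<and>
        snd s' = m(2 := (m 2)(i * q + n := of_bool (\<not> usable i n)))" for s'
    ultimately have "wp W ?body Q s"
      using n size word_bounds(1) word_bounds(2)[OF i]
      by (cases "avail i n"; cases "n < lo"; cases "high i < n") (simp_all add: s frame_def regs)
    then have "runs W ?body s 12 Q" by (intro runs_straight_le) auto
    then have "runs W ?body s 12 (row_inv i (Suc n))"
    proof (rule runs_weaken)
      fix s' assume Q: "Q s'"
      have "{j. j < Suc n \<and> usable i j} = (if usable i n then insert n else id) {j. j < n \<and> usable i j}"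
        by (auto simp: less_Suc_eq)
      then have card: "card {j. j < Suc n \<and> usable i j} = card {j. j < n \<and> usable i j} + of_bool (usable i n)"
        by auto
      have last: "\<exists>j<Suc n. usable i j \<and> fst s' 15 = i * q + j" if "0 < fst s' 14"
      proof (cases "usable i n")
        case False
        then have "\<exists>j<n. usable i j \<and> fst s' 15 = i * q + j"
          using I Q that by (simp add: s row_inv_def Q_def)
        then show ?thesis using less_SucI by blast
      qed (use Q in \<open>auto simp: Q_def\<close>)
      have m2: "m 2 (k * q + j) = (if k = i \<and> j < n then of_bool (\<not> usable i j) else marked i k j)"
        if "j < q" for k j
        using I that by (simp add: s row_inv_def)
      have "snd s' 2 (k * q + j) = (if k = i \<and> j < Suc n then of_bool (\<not> usable i j) else marked i k j)"
        if "j < q" for k j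
        using Q m2[OF that] address_eq_iff[OF that, of n k i] n by (auto simp: Q_def)
      then show "row_inv i (Suc n) s'"
        using I Q card last regs(13) by (simp add: s row_inv_def forward_frame_def Q_def lo_def)
    qed simp
    then show "holds (Less 6 13) (fst s) \<and> runs W ?body s 12 (row_inv i (Suc n))"
      using I n by (simp add: row_inv_def)
  qed (use inv in \<open>auto simp: row_inv_def\<close>)
  then show ?thesis by (rule runs_weaken) auto
qed

lemma usable_less: "usable i j \<Longrightarrow> j < min q (Suc i)"
  using avail_less high_le[of i] by (auto simp: usable_def intro: le_less_trans)

lemma runs_forward_end:
  assumes i: "i < p" and inv: "row_inv i (min q (Suc i)) s"
  shows "runs W forward_end s 9 (forward_inv (Suc i))"
proof -
  obtain r m where s: "s = (r, m)" by (cases s)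
  let ?U = "{j. usable i j}"
  \<comment> \<open>All usable columns lie in the scanned part of the row, so register 14 counts
    every one of them.\<close>
  have U: "{j. j < min q (Suc i) \<and> usable i j} = ?U" using usable_less by blast
  have m2: "m 2 (k * q + j) = marked (Suc i) k j" if "j < q" for k j
    using inv that unfolding row_inv_def s by (auto simp: marked_def less_Suc_eq)
  have m3: "m 3 (k * q + j) = forced i k j" if "j < q" for k j
    using inv that unfolding row_inv_def forward_frame_def s by auto
  have m3': "((m 3)(r 15 := Suc 0)) (k * q + j) = forced (Suc i) k j" if "r 14 = Suc 0" "j < q" for k j
  proof -
    have "card ?U = 1" using inv that U unfolding row_inv_def s by auto
    moreover obtain l where l: "usable i l" "r 15 = i * q + l" "l < q"
      using inv \<open>r 14 = Suc 0\<close> unfolding row_inv_def s by auto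
    ultimately have "?U = {l}" by (metis card_1_singletonE mem_Collect_eq singletonD)
    then show ?thesis using l that m3 address_eq_iff[of j q l k i] by (auto simp: forced_def less_Suc_eq)
  qed
  have m3'': "m 3 (k * q + j) = forced (Suc i) k j" if "r 14 \<noteq> Suc 0" "j < q" for k j
  proof -
    have "card ?U \<noteq> 1" using inv that U unfolding row_inv_def s by auto
    then show ?thesis using m3 that by (auto simp: forced_def less_Suc_eq)
  qed
  have At: "A (i * q + high i) = of_bool (\<not> avail i (high i))" if "high i < q"
    using A i that by simp
  have nq: "\<not> avail i (high i)" if "\<not> high i < q" using that avail_less by blast
  have regs: "r 0 = p" "r (Suc 0) = q" "r 2 = Suc 0" "r 3 = 0" "r 4 = i" "r 5 = i * q"
      "r 7 = high i" "m 0 = A"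
    using inv by (simp_all add: s row_inv_def forward_frame_def frame_def)
  define Q :: "state \<Rightarrow> bool" where "Q s' \<longleftrightarrow> frame s' \<and> fst s' 4 = Suc i \<and> fst s' 5 = Suc i * q \<and>
      fst s' 7 = high (Suc i) \<and> snd s' = (if r 14 = Suc 0 then m(3 := (m 3)(r 15 := Suc 0)) else m)" for s'
  have "wp W forward_end Q s"
    using size word_bounds(1) word_bounds(2)[OF i] i high_le_width[of i] At nq
    by (cases "r 14 = Suc 0"; cases "high i < q"; cases "avail i (high i)")
      (simp_all add: s forward_end_def Q_def frame_def regs)
  then have "runs W forward_end s 9 Q" by (intro runs_straight_le) (auto simp: forward_end_def)
  then show ?thesis
  proof (rule runs_weaken)
    fix s' assume "Q s'"
    moreover have "\<forall>k<p. m 4 k = low (Suc k)" using inv by (simp add: s row_inv_def forward_frame_def)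
    ultimately show "forward_inv (Suc i) s'"
      using m2 m3' m3'' by (cases "r 14 = Suc 0") (simp_all add: Q_def forward_inv_def forward_frame_def)
  qed simp
qed

lemma runs_forward_pass:
  assumes "forward_inv 0 s"
  shows "runs W forward_pass s (p * (q * 13 + 20) + 1) (forward_inv p)"
proof -
  have "runs W forward_pass s (p * Suc (q * 13 + 19) + 1) (forward_inv p)"
    unfolding forward_pass_def
  proof (rule runs_While[where I = forward_inv])
    fix i and s :: state assume i: "i < p" and I: "forward_inv i s"
    have "runs W (seqs [forward_start, mark_row, forward_end]) s (9 + (q * 13 + 1 + 9)) (forward_inv (Suc i))"
      unfolding seqs.simps
      by (rule runs_Seq, rule runs_forward_start[OF i I], rule runs_Seq,
        erule runs_mark_row[OF i], erule runs_forward_end[OF i])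
    then have "runs W (seqs [forward_start, mark_row, forward_end]) s (q * 13 + 19) (forward_inv (Suc i))"
      by (rule runs_weaken) simp_all
    moreover have "holds (Less 4 0) (fst s)" using I i by (simp add: forward_inv_def forward_frame_def frame_def)
    ultimately show "holds (Less 4 0) (fst s) \<and>
        runs W (seqs [forward_start, mark_row, forward_end]) s (q * 13 + 19) (forward_inv (Suc i))"
      by blast
  qed (use assms in \<open>auto simp: forward_inv_def forward_frame_def frame_def\<close>)
  then show ?thesis by (rule runs_weaken) simp_all
qed

definition final :: "state \<Rightarrow> bool" where
  "final s \<longleftrightarrow> (if low 0 = 0 then fst s 0 = 1 \<and>
       (\<forall>i j. j < q \<longrightarrow> snd s 2 (i * q + j) = marked p i j \<and> snd s 3 (i * q + j) = forced p i j)
     else fst s 0 = 0)"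

lemma runs_fixing:
  assumes s: "fst s = (\<lambda>_. 0)(0 := p, 1 := q)" "snd s 0 = A" "snd s 2 = (\<lambda>_. 0)" "snd s 3 = (\<lambda>_. 0)"
  shows "runs W fixing s (100 * (p * q)) final"
proof -
  define I where "I i s \<longleftrightarrow> frame s \<and> fst s 4 = i \<and> fst s 5 = i * q \<and> fst s 7 = 0 \<and>
     snd s 2 = (\<lambda>_. 0) \<and> snd s 3 = (\<lambda>_. 0)" for i and s :: state
  have 1: "runs W (Const 2 1) s 1 (I 0)"
    by (cases s; rule runs_straight_le) (use s size word_bounds(1) in \<open>auto simp: I_def frame_def\<close>)
  have 2: "runs W (While (Less 4 0) (seqs [Add 4 4 2, Add 5 5 1])) s (p * Suc 2 + 1) (I p)"
    if "I 0 s" for s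
  proof (rule runs_While[where I = I])
    fix i and s :: state assume i: "i < p" and Ii: "I i s"
    have "runs W (seqs [Add 4 4 2, Add 5 5 1]) s 2 (I (Suc i))"
      by (rule runs_straight_le, simp, cases s)
        (use Ii i size word_bounds(1) word_bounds(2)[OF i] in \<open>auto simp: I_def frame_def\<close>)
    then show "holds (Less 4 0) (fst s) \<and> runs W (seqs [Add 4 4 2, Add 5 5 1]) s 2 (I (Suc i))"
      using Ii i by (simp add: I_def frame_def)
  qed (use that in \<open>auto simp: I_def frame_def\<close>)
  have 3: "runs W backward_pass s (p * (q * 4 + 16) + 1) (backward_inv 0)" if "I p s" for s
    by (rule runs_backward_pass) (use that in \<open>auto simp: I_def backward_inv_def\<close>)
  have 4: "runs W (Cond (Less 3 7) (Const 0 0) (Seq forward_pass (Const 0 1))) s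
      (Suc (p * (q * 13 + 20) + 1 + 1)) final" if inv: "backward_inv 0 s" for s
  proof (rule runs_Cond)
    assume "holds (Less 3 7) (fst s)"
    then have "low 0 \<noteq> 0" using inv by (simp add: backward_inv_def frame_def)
    then have "runs W (Const 0 0) s 1 final"
      by (cases s; intro runs_straight_le) (auto simp: final_def)
    then show "runs W (Const 0 0) s (p * (q * 13 + 20) + 1 + 1) final"
      by (rule runs_weaken) auto
  next
    assume "\<not> holds (Less 3 7) (fst s)"
    then have low: "low 0 = 0" using inv by (simp add: backward_inv_def frame_def)
    have "forward_inv 0 s" using inv low
      by (auto simp: backward_inv_def forward_inv_def forward_frame_def marked_def forced_def)
    then have "runs W forward_pass s (p * (q * 13 + 20) + 1) (forward_inv p)" by (rule runs_forward_pass)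
    then show "runs W (Seq forward_pass (Const 0 1)) s (p * (q * 13 + 20) + 1 + 1) final"
    proof (rule runs_Seq)
      fix s :: state assume "forward_inv p s"
      then show "runs W (Const 0 1) s 1 final"
        by (cases s; intro runs_straight_le)
          (use low size word_bounds(1) in \<open>auto simp: final_def forward_inv_def forward_frame_def\<close>)
    qed
  qed
  have "runs W fixing s (1 + (p * Suc 2 + 1 + (p * (q * 4 + 16) + 1 +
      Suc (p * (q * 13 + 20) + 1 + 1)))) final"
    unfolding fixing_def seqs.simps
    by (rule runs_Seq, rule 1, rule runs_Seq, erule 2[unfolded seqs.simps], rule runs_Seq, erule 3, erule 4)
  \<comment> \<open>Per cell 4 steps for the scan and 13 for the marking; per row 3 + 16 + 20. As
    \<open>p * q\<close> bounds \<open>p\<close> and 1, the factor 62 suffices; 100 is a round value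
    that also serves as the word bound.\<close>
  moreover have "1 + (p * Suc 2 + 1 + (p * (q * 4 + 16) + 1 + Suc (p * (q * 13 + 20) + 1 + 1))) =
      17 * (p * q) + 39 * p + 6"
    by (simp add: algebra_simps)
  moreover have "p \<le> p * q" "1 \<le> p" using size by simp_all
  then have "17 * (p * q) + 39 * p + 6 \<le> 100 * (p * q)" by linarith
  ultimately show ?thesis
    by (metis runs_weaken)
qed

end

theorem theorem4:
  shows "\<exists>(prog :: com) (C :: nat). \<forall>(p :: nat) (q :: nat) I0 I1.
    2 \<le> q \<longrightarrow> q \<le> p \<longrightarrow> I0 \<subseteq> indices p q \<longrightarrow> I1 \<subseteq> indices p q \<longrightarrow>
    P1 p q I0 \<longrightarrow> P2 q I0 I1 \<longrightarrow>
    (\<exists>t s. exec (C * (p * q)) prog (input_state p q I0 I1) t s \<and>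
           t \<le> C * (p * q) \<and> correct_output p q I0 I1 s)"
proof (rule exI[of _ fixing], rule exI[of _ 100], intro allI impI)
  fix p q :: nat and I0 I1
  assume q: "2 \<le> q" "q \<le> p" and I: "I0 \<subseteq> indices p q" "I1 \<subseteq> indices p q"
    and P1: "P1 p q I0" and P2: "P2 q I0 I1"
  define A :: "nat \<Rightarrow> nat" where "A k = of_bool (k < p * q \<and> position q k \<in> I0)" for k
  interpret row_choices p q "available q I0"
    by (rule row_choices_available) (use I P1 q in auto)
  have pos: "position q (i * q + j) = (Suc i, Suc j)" if "j < q" for i j
    using that by (simp add: position_def)
  interpret fixing_run p q "available q I0" "100 * (p * q)" A
  proof
    show "A (i * q + j) = of_bool (\<not> available q I0 i j)" if "i < p" "j < q" for i j
      using that address_less[OF that] pos by (simp add: A_def available_def)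
  qed (use q in \<open>auto simp: A_def\<close>)
  have "runs (100 * (p * q)) fixing (input_state p q I0 I1) (100 * (p * q)) final"
    by (rule runs_fixing) (auto simp: input_state_def A_def)
  then obtain t s where run: "exec (100 * (p * q)) fixing (input_state p q I0 I1) t s"
      "t \<le> 100 * (p * q)" and fin: "final s"
    by (auto simp: runs_def)
  let ?F = "cube_face p q I0 I1" and ?P = "partitioning_orbitope p q"
  note fixed = fixed_to_eq[OF I P2]
  have Fix: "Fix p q ?F ?P = (if low 0 = 0 then cube_face p q (fixed_to 0 p q ?F ?P) (fixed_to 1 p q ?F ?P) else {})"
  proof -
    have "?P \<inter> ?F \<subseteq> cube p q" by (auto simp: cube_face_def)
    then show ?thesis using Fix_eq[of ?P ?F p q] fixed(1) growth_choice_ex by simp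
  qed
  \<comment> \<open>\<open>correct_output\<close> branches on emptiness of \<open>Fix\<close>; any
    0/1-point of the orbitope in the given face witnesses that the computed face is
    nonempty.\<close>
  have nonempty: "cube_face p q (fixed_to 0 p q ?F ?P) (fixed_to 1 p q ?F ?P) \<noteq> {}" if "low 0 = 0"
  proof -
    have "binary_points p q (?P \<inter> ?F) \<noteq> {}" using fixed(1) growth_choice_ex that by simp
    then obtain x where "x \<in> binary_points p q (?P \<inter> ?F)" by blast
    then have "x \<in> cube_face p q (fixed_to 0 p q ?F ?P) (fixed_to 1 p q ?F ?P)"
      by (auto simp: cube_face_def binary_points_def fixed_to_def)
    then show ?thesis by blast
  qed
  have cells: "stores_set p q a J" if "\<And>i j. i < p \<Longrightarrow> j < q \<Longrightarrow> a (i * q + j) = of_bool ((Suc i, Suc j) \<in> J)"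
    for a J
    unfolding stores_set_def
  proof (intro allI impI)
    fix k assume k: "k < p * q"
    have "k div q < p" "k mod q < q" using k q by (auto simp: less_mult_imp_div_less)
    from that[OF this] show "a k = of_bool (position q k \<in> J)" by (simp add: position_def)
  qed
  have "correct_output p q I0 I1 s"
  proof (cases "low 0 = 0")
    case False
    then show ?thesis using Fix fin by (simp add: correct_output_def final_def)
  next
    case True
    have "stores_set p q (snd s 2) (fixed_to 0 p q ?F ?P)"
      by (rule cells) (use fin True in \<open>simp add: final_def marked_def fixed(2) usable_iff[OF True]\<close>)
    moreover have "stores_set p q (snd s 3) (fixed_to 1 p q ?F ?P)"
    proof (rule cells)
      fix i j assume ij: "i < p" "j < q"
      have "j \<le> i" if "{k. usable i k} = {j}"
      proof -
        have "usable i j" using that by blast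
        then show ?thesis using usable_less[of i j] by simp
      qed
      then show "snd s 3 (i * q + j) = of_bool ((Suc i, Suc j) \<in> fixed_to 1 p q ?F ?P)"
        using fin True ij by (auto simp: final_def forced_def fixed(3) forced_iff[OF True])
    qed
    moreover have "fst s 0 = 1" using fin True by (simp add: final_def)
    moreover have "Fix p q ?F ?P = cube_face p q (fixed_to 0 p q ?F ?P) (fixed_to 1 p q ?F ?P)"
      using Fix True by simp
    ultimately show ?thesis using nonempty[OF True] unfolding correct_output_def Let_def by simp
  qed
  with run show "\<exists>t s. exec (100 * (p * q)) fixing (input_state p q I0 I1) t s \<and>
      t \<le> 100 * (p * q) \<and> correct_output p q I0 I1 s" by blast
qed

end
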